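(* Let $j$ and $n$ be non-negative integers. If $R$ is a commutative Artin ring, then the following statements are equivalent: (1) $\mathrm{ext.dim}(\Omega^{j}(R\text{-}\mathrm{mod}))\leq n$; (2) $\mathrm{ext.dim}(\Omega^{j}(R_{\mathfrak{p}}\text{-}\mathrm{mod}))\leq n$ for every $\mathfrak{p}\in\mathrm{Spec}(R)$; (3) $\mathrm{ext.dim}(\Omega^{j}(R_{\mathfrak{m}}\text{-}\mathrm{mod}))\leq n$ for every $\mathfrak{m}\in\mathrm{Max}(R)$.
   Context: For an Artin ring $A$, $A\text{-}\mathrm{mod}$ is the category of finitely generated left $A$-modules; subcategories are full, additive and closed under isomorphisms. $\mathrm{Spec}(R)$ and $\mathrm{Max}(R)$ are the sets of prime and maximal ideals of $R$, and $R_{\mathfrak{p}}$ is the localization at $\mathfrak{p}$. Extension dimension. For a subcategory (or class of objects) $\mathcal{U}$ of $A\text{-}\mathrm{mod}$, $\mathrm{add}(\mathcal{U})$ is the smallest full subcategory of $A\text{-}\mathrm{mod}$ containing $\mathcal{U}$ and closed under finite direct sums and direct summands. For subcategories $\mathcal{U},\mathcal{V}$, $\mathcal{U}\ast\mathcal{V}$ is the full subcategory of modules $X$ fitting into a short exact sequence $0\to U\to X\to V\to 0$ with $U\in\mathcal{U}$, $V\in\mathcal{V}$. Put $[\mathcal{U}]_0$ = the zero modules, $[\mathcal{U}]_1=\mathrm{add}(\mathcal{U})$, and $[\mathcal{U}]_n=\mathrm{add}([\mathcal{U}]_{n-1}\ast[\mathcal{U}]_1)$ for $n\geq 2$; write $[M]_n=[\{M\}]_n$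 for a module $M$. The extension dimension is $\mathrm{ext.dim}(\mathcal{U})=\inf\{n\geq 0\mid \mathcal{U}\subseteq [N]_{n+1}\text{ for some }N\in A\text{-}\mathrm{mod}\}$, or $\infty$ if no such $n$ exists. Syzygies. For $n\geq 1$ and $M\in A\text{-}\mathrm{mod}$, a module $K$ is an $n$-th syzygy module of $M$ if there is an exact sequence $\cdots\to P_n\to P_{n-1}\to\cdots\to P_0\to M\to 0$ in $A\text{-}\mathrm{mod}$ with all $P_i$ projective and $K\cong\mathrm{Im}(P_n\to P_{n-1})$; the $0$-th syzygy of $M$ is $M$ (up to isomorphism). $\Omega^n(A\text{-}\mathrm{mod})$ is the full subcategory of $A\text{-}\mathrm{mod}$ of all $n$-th syzygy modules, and $\Omega^0(A\text{-}\mathrm{mod})=A\text{-}\mathrm{mod}$. *)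

theory Defs
  imports "HOL-Algebra.Module" "HOL-Algebra.Chinese_Remainder" "HOL-Library.Extended_Nat"
begin

section \<open>Commutative Artin rings and localization\<close>

locale artinian_cring = cring +
  assumes descending_chain:
    "\<lbrakk>\<And>k. ideal (I k) R; \<And>k. I (Suc k) \<subseteq> I k\<rbrakk> \<Longrightarrow> \<exists>m. \<forall>k\<ge>m. I k = I (m :: nat)"

definition frac_rel :: "('a, 'b) ring_scheme \<Rightarrow> 'a set \<Rightarrow> (('a \<times> 'a) \<times> ('a \<times> 'a)) set" where
  "frac_rel R S = {((a, s), (b, t)). a \<in> carrier R \<and> s \<in> S \<and> b \<in> carrier R \<and> t \<in> S \<and>
     (\<exists>u\<in>S. u \<otimes>\<^bsub>R\<^esub> (t \<otimes>\<^bsub>R\<^esub> a) = u \<otimes>\<^bsub>R\<^esub> (s \<otimes>\<^bsub>R\<^esub> b))}"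

text \<open>The fraction \<open>a / s\<close>.\<close>

definition fraction :: "('a, 'b) ring_scheme \<Rightarrow> 'a set \<Rightarrow> 'a \<Rightarrow> 'a \<Rightarrow> ('a \<times> 'a) set" where
  "fraction R S a s = frac_rel R S `` {(a, s)}"

text \<open>
  The operations are defined on equivalence classes by taking the union over all
  representatives; the classes in that union all coincide, cf. \<open>fraction_add\<close> and \<open>fraction_mult\<close> below.
\<close>

definition localization :: "('a, 'b) ring_scheme \<Rightarrow> 'a set \<Rightarrow> ('a \<times> 'a) set ring" where
  "localization R S = \<lparr>
     carrier = (carrier R \<times> S) // frac_rel R S,
     mult = (\<lambda>X Y. \<Union>{fraction R S (a \<otimes>\<^bsub>R\<^esub> b) (s \<otimes>\<^bsub>R\<^esub> t) | a s b t.
               (a, s) \<in> X \<and> (b, t) \<in> Y}),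
     one = fraction R S \<one>\<^bsub>R\<^esub> \<one>\<^bsub>R\<^esub>,
     zero = fraction R S \<zero>\<^bsub>R\<^esub> \<one>\<^bsub>R\<^esub>,
     add = (\<lambda>X Y. \<Union>{fraction R S (t \<otimes>\<^bsub>R\<^esub> a \<oplus>\<^bsub>R\<^esub> s \<otimes>\<^bsub>R\<^esub> b) (s \<otimes>\<^bsub>R\<^esub> t) | a s b t.
              (a, s) \<in> X \<and> (b, t) \<in> Y})\<rparr>"

definition localization_at :: "('a, 'b) ring_scheme \<Rightarrow> 'a set \<Rightarrow> ('a \<times> 'a) set ring" where
  "localization_at R P = localization R (carrier R - P)"

locale mult_subset = cring R + submonoid S R for R (structure) and S
begin

lemma mem_carr [simp]: "s \<in> S \<Longrightarrow> s \<in> carrier R"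
  using subset by auto

declare one_closed [simp] m_closed [simp]

lemma frac_rel_iff:
  "((a, s), (b, t)) \<in> frac_rel R S \<longleftrightarrow> a \<in> carrier R \<and> s \<in> S \<and> b \<in> carrier R \<and> t \<in> S \<and>
     (\<exists>u\<in>S. u \<otimes> (t \<otimes> a) = u \<otimes> (s \<otimes> b))"
  by (simp add: frac_rel_def)

lemma equiv_frac_rel: "equiv (carrier R \<times> S) (frac_rel R S)"
proof (rule equivI)
  show "frac_rel R S \<subseteq> (carrier R \<times> S) \<times> (carrier R \<times> S)"
    by (auto simp: frac_rel_def)
  show "refl_on (carrier R \<times> S) (frac_rel R S)"
    by (auto simp: refl_on_def frac_rel_def intro!: bexI[of _ \<one>])
  show "sym (frac_rel R S)"
    by (rule symI) (force simp: frac_rel_def)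
  show "trans (frac_rel R S)"
  proof (rule transI, clarify)
    fix a s b t c r
    assume A: "((a, s), (b, t)) \<in> frac_rel R S" and B: "((b, t), (c, r)) \<in> frac_rel R S"
    obtain u where u: "u \<in> S" "u \<otimes> (t \<otimes> a) = u \<otimes> (s \<otimes> b)" using A frac_rel_iff by auto
    obtain v where v: "v \<in> S" "v \<otimes> (r \<otimes> b) = v \<otimes> (t \<otimes> c)" using B frac_rel_iff by auto
    have m: "a \<in> carrier R" "b \<in> carrier R" "c \<in> carrier R" "s \<in> S" "t \<in> S" "r \<in> S"
      using A B frac_rel_iff by auto
    have mc: "s \<in> carrier R" "t \<in> carrier R" "r \<in> carrier R" "u \<in> carrier R" "v \<in> carrier R"
      using m u v by auto
    have "(u \<otimes> v \<otimes> t) \<otimes> (r \<otimes> a) = (v \<otimes> r) \<otimes> (u \<otimes> (t \<otimes> a))"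
      using m(1-3) mc by (simp add: m_ac)
    also have "\<dots> = (u \<otimes> s) \<otimes> (v \<otimes> (r \<otimes> b))"
      unfolding u using m(1-3) mc by (simp add: m_ac)
    also have "\<dots> = (u \<otimes> v \<otimes> t) \<otimes> (s \<otimes> c)"
      unfolding v using m(1-3) mc by (simp add: m_ac)
    finally show "((a, s), (c, r)) \<in> frac_rel R S"
      using m u(1) v(1) frac_rel_iff by auto
  qed
qed

lemma fraction_eq_iff:
  assumes "a \<in> carrier R" "b \<in> carrier R" "s \<in> S" "t \<in> S"
  shows "fraction R S a s = fraction R S b t \<longleftrightarrow> (\<exists>u\<in>S. u \<otimes> (t \<otimes> a) = u \<otimes> (s \<otimes> b))"
  unfolding fraction_def
  using eq_equiv_class_iff[OF equiv_frac_rel, of "(a, s)" "(b, t)"] assms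
  by (simp add: frac_rel_iff)

lemma fraction_eqI:
  assumes "a \<in> carrier R" "b \<in> carrier R" "s \<in> S" "t \<in> S" "t \<otimes> a = s \<otimes> b"
  shows "fraction R S a s = fraction R S b t"
  using assms by (subst fraction_eq_iff) (auto intro!: bexI[of _ \<one>])

lemma fraction_closed [simp]:
  "a \<in> carrier R \<Longrightarrow> s \<in> S \<Longrightarrow> fraction R S a s \<in> carrier (localization R S)"
  by (auto simp: localization_def fraction_def intro!: quotientI)

lemma fraction_cases:
  assumes "X \<in> carrier (localization R S)"
  obtains a s where "a \<in> carrier R" "s \<in> S" "X = fraction R S a s"
  using assms by (auto simp: localization_def fraction_def elim!: quotientE)

lemma mem_fraction:
  assumes "(c, r) \<in> fraction R S a s" "a \<in> carrier R" "s \<in> S"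
  shows "c \<in> carrier R \<and> r \<in> S \<and> (\<exists>u\<in>S. u \<otimes> (r \<otimes> a) = u \<otimes> (s \<otimes> c))"
  using assms by (simp add: fraction_def frac_rel_iff)

lemma self_mem_fraction: "a \<in> carrier R \<Longrightarrow> s \<in> S \<Longrightarrow> (a, s) \<in> fraction R S a s"
  unfolding fraction_def by (rule equiv_class_self[OF equiv_frac_rel]) simp

lemma Union_const:
  assumes "(a, s) \<in> X" "(b, t) \<in> Y"
    "\<And>a' s' b' t'. (a', s') \<in> X \<Longrightarrow> (b', t') \<in> Y \<Longrightarrow> f a' s' b' t' = f a s b t"
  shows "\<Union>{f a s b t | a s b t. (a, s) \<in> X \<and> (b, t) \<in> Y} = f a s b t"
proof -
  have "{f a s b t | a s b t. (a, s) \<in> X \<and> (b, t) \<in> Y} = {f a s b t}"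
  proof (intro equalityI subsetI)
    fix z assume "z \<in> {f a s b t | a s b t. (a, s) \<in> X \<and> (b, t) \<in> Y}"
    then obtain a' s' b' t' where "(a', s') \<in> X" "(b', t') \<in> Y" "z = f a' s' b' t'" by blast
    then show "z \<in> {f a s b t}" using assms(3) by simp
  next
    fix z assume "z \<in> {f a s b t}"
    then show "z \<in> {f a s b t | a s b t. (a, s) \<in> X \<and> (b, t) \<in> Y}" using assms(1,2) by blast
  qed
  then show ?thesis by simp
qed

lemma fraction_mult:
  assumes "a \<in> carrier R" "b \<in> carrier R" "s \<in> S" "t \<in> S"
  shows "fraction R S a s \<otimes>\<^bsub>localization R S\<^esub> fraction R S b t = fraction R S (a \<otimes> b) (s \<otimes> t)"
proof -
  have "fraction R S (a' \<otimes> b') (s' \<otimes> t') = fraction R S (a \<otimes> b) (s \<otimes> t)"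
    if x: "(a', s') \<in> fraction R S a s" and y: "(b', t') \<in> fraction R S b t" for a' s' b' t'
  proof -
    obtain u where u: "u \<in> S" "u \<otimes> (s' \<otimes> a) = u \<otimes> (s \<otimes> a')"
      and m: "a' \<in> carrier R" "s' \<in> S"
      using mem_fraction[OF x] assms by blast
    obtain v where v: "v \<in> S" "v \<otimes> (t' \<otimes> b) = v \<otimes> (t \<otimes> b')"
      and m': "b' \<in> carrier R" "t' \<in> S"
      using mem_fraction[OF y] assms by blast
    note mc = assms(1,2) m(1) m'(1) mem_carr[OF assms(3)] mem_carr[OF assms(4)]
      mem_carr[OF m(2)] mem_carr[OF m'(2)] mem_carr[OF u(1)] mem_carr[OF v(1)]
    have "(u \<otimes> v) \<otimes> ((s \<otimes> t) \<otimes> (a' \<otimes> b')) = (u \<otimes> (s \<otimes> a')) \<otimes> (v \<otimes> (t \<otimes> b'))"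
      using mc by (simp add: r_distr m_ac)
    also have "\<dots> = (u \<otimes> v) \<otimes> ((s' \<otimes> t') \<otimes> (a \<otimes> b))"
      unfolding u(2)[symmetric] v(2)[symmetric] using mc by (simp add: r_distr m_ac)
    finally show ?thesis
      using assms m m' u(1) v(1) by (auto simp: fraction_eq_iff intro!: bexI[of _ "u \<otimes> v"])
  qed
  from Union_const[where f = "\<lambda>a s b t. fraction R S (a \<otimes> b) (s \<otimes> t)",
      OF self_mem_fraction[OF assms(1,3)] self_mem_fraction[OF assms(2,4)] this]
  show ?thesis by (simp add: localization_def)
qed
lemma fraction_add:
  assumes "a \<in> carrier R" "b \<in> carrier R" "s \<in> S" "t \<in> S"
  shows "fraction R S a s \<oplus>\<^bsub>localization R S\<^esub> fraction R S b t
       = fraction R S (t \<otimes> a \<oplus> s \<otimes> b) (s \<otimes> t)"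
proof -
  have "fraction R S (t' \<otimes> a' \<oplus> s' \<otimes> b') (s' \<otimes> t') = fraction R S (t \<otimes> a \<oplus> s \<otimes> b) (s \<otimes> t)"
    if x: "(a', s') \<in> fraction R S a s" and y: "(b', t') \<in> fraction R S b t" for a' s' b' t'
  proof -
    obtain u where u: "u \<in> S" "u \<otimes> (s' \<otimes> a) = u \<otimes> (s \<otimes> a')"
      and m: "a' \<in> carrier R" "s' \<in> S"
      using mem_fraction[OF x] assms by blast
    obtain v where v: "v \<in> S" "v \<otimes> (t' \<otimes> b) = v \<otimes> (t \<otimes> b')"
      and m': "b' \<in> carrier R" "t' \<in> S"
      using mem_fraction[OF y] assms by blast
    note mc = assms(1,2) m(1) m'(1) mem_carr[OF assms(3)] mem_carr[OF assms(4)]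
      mem_carr[OF m(2)] mem_carr[OF m'(2)] mem_carr[OF u(1)] mem_carr[OF v(1)]
    have "(u \<otimes> v) \<otimes> ((s \<otimes> t) \<otimes> (t' \<otimes> a' \<oplus> s' \<otimes> b'))
        = (v \<otimes> t \<otimes> t') \<otimes> (u \<otimes> (s \<otimes> a')) \<oplus> (u \<otimes> s \<otimes> s') \<otimes> (v \<otimes> (t \<otimes> b'))"
      using mc by (simp add: r_distr m_ac)
    also have "\<dots> = (u \<otimes> v) \<otimes> ((s' \<otimes> t') \<otimes> (t \<otimes> a \<oplus> s \<otimes> b))"
      unfolding u(2)[symmetric] v(2)[symmetric] using mc by (simp add: r_distr m_ac)
    finally show ?thesis
      using assms m m' u(1) v(1) by (auto simp: fraction_eq_iff intro!: bexI[of _ "u \<otimes> v"])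
  qed
  from Union_const[where f = "\<lambda>a s b t. fraction R S (t \<otimes> a \<oplus> s \<otimes> b) (s \<otimes> t)",
      OF self_mem_fraction[OF assms(1,3)] self_mem_fraction[OF assms(2,4)] this]
  show ?thesis by (simp add: localization_def)
qed
lemma localization_one: "\<one>\<^bsub>localization R S\<^esub> = fraction R S \<one> \<one>"
  and localization_zero: "\<zero>\<^bsub>localization R S\<^esub> = fraction R S \<zero> \<one>"
  by (simp_all add: localization_def)

lemma cring_localization: "cring (localization R S)"
proof (rule cringI)
  let ?L = "localization R S"
  note loc = fraction_mult fraction_add localization_one localization_zero
  show "abelian_group ?L"
  proof (rule abelian_groupI)
    show "\<zero>\<^bsub>?L\<^esub> \<in> carrier ?L" by (simp add: loc)
    fix X assume "X \<in> carrier ?L"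
    then obtain a s where X: "a \<in> carrier R" "s \<in> S" "X = fraction R S a s" by (rule fraction_cases)
    show "\<zero>\<^bsub>?L\<^esub> \<oplus>\<^bsub>?L\<^esub> X = X" using X by (simp add: loc)
    have "s \<otimes> \<ominus> a \<oplus> s \<otimes> a = \<zero>" using X(1) mem_carr[OF X(2)] by (simp add: r_minus l_neg)
    then have "fraction R S (\<ominus> a) s \<oplus>\<^bsub>?L\<^esub> X = \<zero>\<^bsub>?L\<^esub>"
      using X by (simp add: loc) (rule fraction_eqI; simp)
    then show "\<exists>Y\<in>carrier ?L. Y \<oplus>\<^bsub>?L\<^esub> X = \<zero>\<^bsub>?L\<^esub>"
      using X by (intro bexI[of _ "fraction R S (\<ominus> a) s"]) simp_all
    fix Y assume "Y \<in> carrier ?L"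
    then obtain b t where Y: "b \<in> carrier R" "t \<in> S" "Y = fraction R S b t" by (rule fraction_cases)
    show "X \<oplus>\<^bsub>?L\<^esub> Y \<in> carrier ?L" using X Y by (simp add: loc)
    show "X \<oplus>\<^bsub>?L\<^esub> Y = Y \<oplus>\<^bsub>?L\<^esub> X"
      using X Y by (simp add: loc m_comm[of s t] add.m_comm[of "t \<otimes> a"])
    fix Z assume "Z \<in> carrier ?L"
    then obtain c r where Z: "c \<in> carrier R" "r \<in> S" "Z = fraction R S c r" by (rule fraction_cases)
    have "r \<otimes> (t \<otimes> a \<oplus> s \<otimes> b) \<oplus> s \<otimes> t \<otimes> c = t \<otimes> r \<otimes> a \<oplus> s \<otimes> (r \<otimes> b \<oplus> t \<otimes> c)"
      using X(1) Y(1) Z(1) mem_carr[OF X(2)] mem_carr[OF Y(2)] mem_carr[OF Z(2)]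
      by (simp add: r_distr m_ac a_ac)
    then show "(X \<oplus>\<^bsub>?L\<^esub> Y) \<oplus>\<^bsub>?L\<^esub> Z = X \<oplus>\<^bsub>?L\<^esub> (Y \<oplus>\<^bsub>?L\<^esub> Z)"
      using X Y Z by (simp add: loc m_assoc)
  qed
  show "Group.comm_monoid ?L"
  proof (rule comm_monoidI)
    show "\<one>\<^bsub>?L\<^esub> \<in> carrier ?L" by (simp add: loc)
    fix X assume "X \<in> carrier ?L"
    then obtain a s where X: "a \<in> carrier R" "s \<in> S" "X = fraction R S a s" by (rule fraction_cases)
    show "\<one>\<^bsub>?L\<^esub> \<otimes>\<^bsub>?L\<^esub> X = X" using X by (simp add: loc)
    fix Y assume "Y \<in> carrier ?L"
    then obtain b t where Y: "b \<in> carrier R" "t \<in> S" "Y = fraction R S b t" by (rule fraction_cases)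
    show "X \<otimes>\<^bsub>?L\<^esub> Y \<in> carrier ?L" using X Y by (simp add: loc)
    show "X \<otimes>\<^bsub>?L\<^esub> Y = Y \<otimes>\<^bsub>?L\<^esub> X"
      using X Y by (simp add: loc m_comm[of s t] m_comm[of a b])
    fix Z assume "Z \<in> carrier ?L"
    then obtain c r where Z: "c \<in> carrier R" "r \<in> S" "Z = fraction R S c r" by (rule fraction_cases)
    show "(X \<otimes>\<^bsub>?L\<^esub> Y) \<otimes>\<^bsub>?L\<^esub> Z = X \<otimes>\<^bsub>?L\<^esub> (Y \<otimes>\<^bsub>?L\<^esub> Z)"
      using X Y Z by (simp add: loc m_assoc)
  qed
  fix X Y Z assume "X \<in> carrier ?L" "Y \<in> carrier ?L" "Z \<in> carrier ?L"
  then obtain a s b t c r where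
    X: "a \<in> carrier R" "s \<in> S" "X = fraction R S a s" and
    Y: "b \<in> carrier R" "t \<in> S" "Y = fraction R S b t" and
    Z: "c \<in> carrier R" "r \<in> S" "Z = fraction R S c r"
    by (metis fraction_cases)
  have "(s \<otimes> r \<otimes> (t \<otimes> r)) \<otimes> ((t \<otimes> a \<oplus> s \<otimes> b) \<otimes> c)
      = (s \<otimes> t \<otimes> r) \<otimes> (t \<otimes> r \<otimes> (a \<otimes> c) \<oplus> s \<otimes> r \<otimes> (b \<otimes> c))"
    using X(1) Y(1) Z(1) mem_carr[OF X(2)] mem_carr[OF Y(2)] mem_carr[OF Z(2)]
    by (simp add: l_distr r_distr m_ac)
  then show "(X \<oplus>\<^bsub>?L\<^esub> Y) \<otimes>\<^bsub>?L\<^esub> Z = X \<otimes>\<^bsub>?L\<^esub> Z \<oplus>\<^bsub>?L\<^esub> Y \<otimes>\<^bsub>?L\<^esub> Z"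
    using X Y Z by (simp add: loc) (rule fraction_eqI; simp)
qed

end

lemma (in primeideal) mult_subset_compl: "mult_subset R (carrier R - I)"
proof (intro mult_subset.intro submonoid.intro)
  show "cring R" by (rule is_cring)
  show "x \<otimes> y \<in> carrier R - I" if "x \<in> carrier R - I" "y \<in> carrier R - I" for x y
    using that I_prime by auto
  show "\<one> \<in> carrier R - I"
    using I_notcarr one_imp_carrier by auto
qed auto

lemma (in primeideal) cring_localization_at: "cring (localization_at R I)"
  unfolding localization_at_def
  by (rule mult_subset.cring_localization[OF mult_subset_compl])


section \<open>The category of finitely generated modules\<close>

text \<open>
  A module record inherits \<open>mult\<close> and \<open>one\<close> from the ring record; these fields carry no
  meaning here and nothing below depends on them.
\<close>

definition mod_hom ::
  "('r, 's) ring_scheme \<Rightarrow> ('r, 'a, 'c) module_scheme \<Rightarrow> ('r, 'b, 'd) module_scheme \<Rightarrow> ('a \<Rightarrow> 'b) set"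
where
  "mod_hom R M N = {h. h \<in> carrier M \<rightarrow> carrier N \<and>
     (\<forall>x\<in>carrier M. \<forall>y\<in>carrier M. h (x \<oplus>\<^bsub>M\<^esub> y) = h x \<oplus>\<^bsub>N\<^esub> h y) \<and>
     (\<forall>a\<in>carrier R. \<forall>x\<in>carrier M. h (a \<odot>\<^bsub>M\<^esub> x) = a \<odot>\<^bsub>N\<^esub> h x)}"

definition mod_iso ::
  "('r, 's) ring_scheme \<Rightarrow> ('r, 'a, 'c) module_scheme \<Rightarrow> ('r, 'b, 'd) module_scheme \<Rightarrow> bool"
where
  "mod_iso R M N \<longleftrightarrow> (\<exists>h\<in>mod_hom R M N. bij_betw h (carrier M) (carrier N))"

definition fin_gen :: "('r, 's) ring_scheme \<Rightarrow> ('r, 'a, 'c) module_scheme \<Rightarrow> bool" where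
  "fin_gen R M \<longleftrightarrow> (\<exists>S. finite S \<and> S \<subseteq> carrier M \<and>
     carrier M = {\<Oplus>\<^bsub>M\<^esub>s\<in>S. c s \<odot>\<^bsub>M\<^esub> s | c. c \<in> S \<rightarrow> carrier R})"

definition mod_dsum ::
  "('r, 'a, 'c) module_scheme \<Rightarrow> ('r, 'b, 'd) module_scheme \<Rightarrow> ('r, 'a \<times> 'b) module"
where
  "mod_dsum M N = ring.extend (RDirProd M N)
     (module.fields (\<lambda>a (x, y). (a \<odot>\<^bsub>M\<^esub> x, a \<odot>\<^bsub>N\<^esub> y)))"

lemma mod_dsum_simps [simp]:
  "carrier (mod_dsum M N) = carrier M \<times> carrier N"
  "\<zero>\<^bsub>mod_dsum M N\<^esub> = (\<zero>\<^bsub>M\<^esub>, \<zero>\<^bsub>N\<^esub>)"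
  "(x, y) \<oplus>\<^bsub>mod_dsum M N\<^esub> (x', y') = (x \<oplus>\<^bsub>M\<^esub> x', y \<oplus>\<^bsub>N\<^esub> y')"
  "a \<odot>\<^bsub>mod_dsum M N\<^esub> (x, y) = (a \<odot>\<^bsub>M\<^esub> x, a \<odot>\<^bsub>N\<^esub> y)"
  by (simp_all add: mod_dsum_def RDirProd_def DirProd_def monoid.defs ring.defs module.defs)

text \<open>
  \<open>R\<close>-mod. HOL cannot quantify over the carrier type inside a formula, so the objects
  have carriers in one fixed type: a module generated by \<open>m\<close> elements is a quotient of
  \<open>R\<^sup>m\<close>, whose elements are cosets, i.e. sets of coordinate functions \<open>nat \<Rightarrow> 'r\<close>. By
  \<open>fg_modules_exhaustive\<close> below, every finitely generated module on any type has an
  isomorphic copy here.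
\<close>

type_synonym 'r fg_module = "('r, (nat \<Rightarrow> 'r) set) module"

definition fg_modules :: "('r, 's) ring_scheme \<Rightarrow> 'r fg_module set" where
  "fg_modules R = {M. Module.module R M \<and> fin_gen R M}"

lemma mod_hom_finsum:
  assumes M: "Module.module R M" and N: "Module.module R N" and h: "h \<in> mod_hom R M N"
    and "finite S" "f \<in> S \<rightarrow> carrier M"
  shows "h (finsum M f S) = finsum N (\<lambda>s. h (f s)) S"
  using assms(4,5)
proof (induction S rule: finite_induct)
  interpret M: Module.module R M by fact
  interpret N: Module.module R N by fact
  case empty
  have c: "h \<zero>\<^bsub>M\<^esub> \<in> carrier N" using h by (auto simp: mod_hom_def)
  have "h \<zero>\<^bsub>M\<^esub> \<oplus>\<^bsub>N\<^esub> h \<zero>\<^bsub>M\<^esub> = h (\<zero>\<^bsub>M\<^esub> \<oplus>\<^bsub>M\<^esub> \<zero>\<^bsub>M\<^esub>)"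
    using h by (simp add: mod_hom_def del: M.M.l_zero M.M.r_zero)
  then have "h \<zero>\<^bsub>M\<^esub> = \<zero>\<^bsub>N\<^esub>"
    using c by (simp add: N.M.add.r_cancel_one')
  then show ?case by simp
next
  interpret M: Module.module R M by fact
  interpret N: Module.module R N by fact
  case (insert x S)
  have "h (finsum M f (insert x S)) = h (f x \<oplus>\<^bsub>M\<^esub> finsum M f S)"
    using insert by (simp add: Pi_def)
  also have "\<dots> = h (f x) \<oplus>\<^bsub>N\<^esub> h (finsum M f S)"
    using insert h by (auto simp: mod_hom_def Pi_def intro!: M.M.finsum_closed)
  also have "\<dots> = finsum N (\<lambda>s. h (f s)) (insert x S)"
    using insert h by (subst N.M.finsum_insert) (auto simp: mod_hom_def Pi_def)
  finally show ?case .
qed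

lemma fin_genE:
  assumes "fin_gen R M"
  obtains S where "finite S" "S \<subseteq> carrier M"
    "\<And>x. x \<in> carrier M \<Longrightarrow> \<exists>c\<in>S \<rightarrow> carrier R. x = (\<Oplus>\<^bsub>M\<^esub>s\<in>S. c s \<odot>\<^bsub>M\<^esub> s)"
proof -
  obtain S where S: "finite S" "S \<subseteq> carrier M"
    and gen: "carrier M = {\<Oplus>\<^bsub>M\<^esub>s\<in>S. c s \<odot>\<^bsub>M\<^esub> s | c. c \<in> S \<rightarrow> carrier R}"
    using assms unfolding fin_gen_def by blast
  have "\<exists>c\<in>S \<rightarrow> carrier R. x = (\<Oplus>\<^bsub>M\<^esub>s\<in>S. c s \<odot>\<^bsub>M\<^esub> s)" if "x \<in> carrier M" for x
  proof -
    have "x \<in> {\<Oplus>\<^bsub>M\<^esub>s\<in>S. c s \<odot>\<^bsub>M\<^esub> s | c. c \<in> S \<rightarrow> carrier R}" using that by (subst (asm) gen)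
    then show ?thesis by blast
  qed
  with S show thesis by (rule that)
qed

lemma fin_gen_transport:
  assumes M: "Module.module R M" and N: "Module.module R N" and h: "h \<in> mod_hom R M N"
    and surj: "h ` carrier M = carrier N" and fg: "fin_gen R M"
    and inj: "inj_on h (carrier M)"
  shows "fin_gen R N"
proof -
  interpret M: Module.module R M by fact
  interpret N: Module.module R N by fact
  obtain S where S: "finite S" "S \<subseteq> carrier M"
    and gen: "\<And>x. x \<in> carrier M \<Longrightarrow> \<exists>c\<in>S \<rightarrow> carrier R. x = (\<Oplus>\<^bsub>M\<^esub>s\<in>S. c s \<odot>\<^bsub>M\<^esub> s)"
    using fin_genE[OF fg] by blast
  have hc: "h x \<in> carrier N" if "x \<in> carrier M" for x using h that by (auto simp: mod_hom_def)
  have injS: "inj_on h S" using inj S(2) inj_on_subset by blast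
  have "y \<in> {\<Oplus>\<^bsub>N\<^esub>s\<in>h ` S. c s \<odot>\<^bsub>N\<^esub> s | c. c \<in> h ` S \<rightarrow> carrier R}" if "y \<in> carrier N" for y
  proof -
    have "y \<in> h ` carrier M" using that surj by simp
    then obtain x where x: "x \<in> carrier M" "y = h x" by blast
    obtain c where c: "c \<in> S \<rightarrow> carrier R" "x = (\<Oplus>\<^bsub>M\<^esub>s\<in>S. c s \<odot>\<^bsub>M\<^esub> s)" using gen[OF x(1)] by blast
    let ?c = "\<lambda>y. c (the_inv_into S h y)"
    have "y = (\<Oplus>\<^bsub>N\<^esub>s\<in>S. h (c s \<odot>\<^bsub>M\<^esub> s))"
      unfolding x c using S c by (intro mod_hom_finsum[OF M N h]) (auto simp: Pi_def)
    also have "\<dots> = (\<Oplus>\<^bsub>N\<^esub>s\<in>S. ?c (h s) \<odot>\<^bsub>N\<^esub> h s)"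
      using h S c hc by (intro N.M.finsum_cong')
        (auto simp: mod_hom_def Pi_def the_inv_into_f_f[OF injS] subset_iff)
    also have "\<dots> = (\<Oplus>\<^bsub>N\<^esub>s\<in>h ` S. ?c s \<odot>\<^bsub>N\<^esub> s)"
      using S c hc injS by (intro N.M.finsum_reindex[symmetric])
        (auto simp: Pi_def the_inv_into_f_f[OF injS] subset_iff)
    finally show ?thesis using c
      by (auto simp: Pi_def the_inv_into_f_f[OF injS] intro!: exI[of _ ?c])
  qed
  moreover have "(\<Oplus>\<^bsub>N\<^esub>s\<in>h ` S. c s \<odot>\<^bsub>N\<^esub> s) \<in> carrier N" if "c \<in> h ` S \<rightarrow> carrier R" for c
    using that S hc by (intro N.M.finsum_closed) (auto simp: Pi_def subset_iff)
  ultimately have "carrier N = {\<Oplus>\<^bsub>N\<^esub>s\<in>h ` S. c s \<odot>\<^bsub>N\<^esub> s | c. c \<in> h ` S \<rightarrow> carrier R}"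
    by blast
  moreover have "finite (h ` S)" "h ` S \<subseteq> carrier N" using S hc by auto
  ultimately show ?thesis unfolding fin_gen_def by blast
qed

lemma module_transport:
  fixes M :: "('r, 'a, 'c) module_scheme" and e :: "'a \<Rightarrow> 'b"
  assumes M: "Module.module R M" and inj: "inj_on e (carrier M)"
  shows "\<exists>N :: ('r, 'b) module. Module.module R N \<and> carrier N = e ` carrier M \<and> e \<in> mod_hom R M N"
proof -
  interpret M: Module.module R M by fact
  define i where "i = the_inv_into (carrier M) e"
  have i [simp]: "i (e x) = x" if "x \<in> carrier M" for x
    using the_inv_into_f_f[OF inj that] by (simp add: i_def)
  define N :: "('r, 'b) module" where
    "N = \<lparr>carrier = e ` carrier M, mult = undefined, one = undefined, zero = e \<zero>\<^bsub>M\<^esub>,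
      add = (\<lambda>x y. e (i x \<oplus>\<^bsub>M\<^esub> i y)), smult = (\<lambda>a x. e (a \<odot>\<^bsub>M\<^esub> i x))\<rparr>"
  have "abelian_group N"
    by (rule abelian_groupI)
       (auto simp: N_def M.M.add.m_ac M.M.r_neg intro!: bexI[of _ "\<ominus>\<^bsub>M\<^esub> _"] M.M.l_neg)
  then have "Module.module R N"
    by (intro moduleI M.R.is_cring)
       (auto simp: N_def M.smult_l_distr M.smult_r_distr M.smult_assoc1)
  moreover have "e \<in> mod_hom R M N" by (auto simp: mod_hom_def N_def)
  moreover have "carrier N = e ` carrier M" by (simp add: N_def)
  ultimately show ?thesis by blast
qed

theorem fg_modules_exhaustive:
  fixes M :: "('r, 'a, 'c) module_scheme"
  assumes M: "Module.module R M" and fg: "fin_gen R M"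
  shows "\<exists>N\<in>fg_modules R. mod_iso R M N"
proof -
  interpret M: Module.module R M by fact
  obtain S where S: "finite S" "S \<subseteq> carrier M"
    and gen: "\<And>x. x \<in> carrier M \<Longrightarrow> \<exists>c\<in>S \<rightarrow> carrier R. x = (\<Oplus>\<^bsub>M\<^esub>s\<in>S. c s \<odot>\<^bsub>M\<^esub> s)"
    using fin_genE[OF fg] by blast
  obtain b where b: "bij_betw b {..<card S} S"
    using ex_bij_betw_nat_finite[OF S(1)] by (auto simp: atLeast0LessThan)
  have bS: "b i \<in> S" if "i < card S" for i using b that by (auto simp: bij_betw_def)
  define e where "e x = {c. c \<in> {..<card S} \<rightarrow> carrier R \<and>
    (\<Oplus>\<^bsub>M\<^esub>i\<in>{..<card S}. c i \<odot>\<^bsub>M\<^esub> b i) = x}" for x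
  have ne: "e x \<noteq> {}" if x: "x \<in> carrier M" for x
  proof -
    obtain c where c: "c \<in> S \<rightarrow> carrier R" "x = (\<Oplus>\<^bsub>M\<^esub>s\<in>S. c s \<odot>\<^bsub>M\<^esub> s)" using gen[OF x] by blast
    have "(\<Oplus>\<^bsub>M\<^esub>i\<in>{..<card S}. c (b i) \<odot>\<^bsub>M\<^esub> b i) = (\<Oplus>\<^bsub>M\<^esub>s\<in>b ` {..<card S}. c s \<odot>\<^bsub>M\<^esub> s)"
      using b S c by (intro M.M.finsum_reindex[symmetric]) (auto simp: bij_betw_def Pi_def)
    also have "b ` {..<card S} = S" using b by (simp add: bij_betw_def)
    finally have "(\<lambda>i. c (b i)) \<in> e x" using c bS by (auto simp: e_def)
    then show ?thesis by auto
  qed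
  have inj: "inj_on e (carrier M)"
  proof (rule inj_onI)
    fix x y assume "x \<in> carrier M" "y \<in> carrier M" "e x = e y"
    moreover obtain c where "c \<in> e x" using ne \<open>x \<in> carrier M\<close> by blast
    ultimately have "c \<in> e x" "c \<in> e y" by auto
    then show "x = y" by (simp add: e_def)
  qed
  obtain N :: "'r fg_module" where
    N: "Module.module R N" "carrier N = e ` carrier M" "e \<in> mod_hom R M N"
    using module_transport[OF M inj] by blast
  have "fin_gen R N" using fin_gen_transport[OF M N(1) N(3)] N(2) fg inj by simp
  with N inj show ?thesis
    by (auto simp: fg_modules_def mod_iso_def bij_betw_def)
qed


section \<open>Extension dimension\<close>

inductive_set add_closure :: "('r, 's) ring_scheme \<Rightarrow> 'r fg_module set \<Rightarrow> 'r fg_module set"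
  for R U where
  base: "\<lbrakk>X \<in> fg_modules R; X \<in> U\<rbrakk> \<Longrightarrow> X \<in> add_closure R U"
| iso: "\<lbrakk>X \<in> add_closure R U; Y \<in> fg_modules R; mod_iso R X Y\<rbrakk> \<Longrightarrow> Y \<in> add_closure R U"
| zero: "\<lbrakk>X \<in> fg_modules R; carrier X = {\<zero>\<^bsub>X\<^esub>}\<rbrakk> \<Longrightarrow> X \<in> add_closure R U"
| dsum: "\<lbrakk>X \<in> add_closure R U; Y \<in> add_closure R U; Z \<in> fg_modules R;
    mod_iso R Z (mod_dsum X Y)\<rbrakk> \<Longrightarrow> Z \<in> add_closure R U"
| summand: "\<lbrakk>Z \<in> add_closure R U; X \<in> fg_modules R; Y \<in> fg_modules R;
    mod_iso R Z (mod_dsum X Y)\<rbrakk> \<Longrightarrow> X \<in> add_closure R U"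

definition short_exact ::
  "('r, 's) ring_scheme \<Rightarrow> ('r, 'a) module \<Rightarrow> ('a \<Rightarrow> 'b) \<Rightarrow> ('r, 'b) module \<Rightarrow> ('b \<Rightarrow> 'c) \<Rightarrow>
    ('r, 'c) module \<Rightarrow> bool"
where
  "short_exact R U f X g V \<longleftrightarrow> f \<in> mod_hom R U X \<and> g \<in> mod_hom R X V \<and>
     inj_on f (carrier U) \<and> f ` carrier U = a_kernel X V g \<and> g ` carrier X = carrier V"

definition ext_prod ::
  "('r, 's) ring_scheme \<Rightarrow> 'r fg_module set \<Rightarrow> 'r fg_module set \<Rightarrow> 'r fg_module set"
where
  "ext_prod R \<U> \<V> = {X \<in> fg_modules R. \<exists>U\<in>\<U>. \<exists>V\<in>\<V>. \<exists>f g. short_exact R U f X g V}"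

fun ext_layer :: "('r, 's) ring_scheme \<Rightarrow> 'r fg_module set \<Rightarrow> nat \<Rightarrow> 'r fg_module set" where
  "ext_layer R U 0 = {X \<in> fg_modules R. carrier X = {\<zero>\<^bsub>X\<^esub>}}"
| "ext_layer R U (Suc 0) = add_closure R U"
| "ext_layer R U (Suc (Suc n)) =
     add_closure R (ext_prod R (ext_layer R U (Suc n)) (add_closure R U))"

text \<open>The infimum of the empty set in \<^typ>\<open>enat\<close> is \<open>\<infinity>\<close>.\<close>

definition ext_dim :: "('r, 's) ring_scheme \<Rightarrow> 'r fg_module set \<Rightarrow> enat" where
  "ext_dim R U = Inf {enat n | n. \<exists>N\<in>fg_modules R. U \<subseteq> ext_layer R {N} (n + 1)}"


section \<open>Syzygies\<close>

text \<open>Projective object of \<open>R\<close>-mod.\<close>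

definition projective :: "('r, 's) ring_scheme \<Rightarrow> 'r fg_module \<Rightarrow> bool" where
  "projective R P \<longleftrightarrow> P \<in> fg_modules R \<and>
     (\<forall>M\<in>fg_modules R. \<forall>N\<in>fg_modules R. \<forall>g\<in>mod_hom R M N. \<forall>f\<in>mod_hom R P N.
        g ` carrier M = carrier N \<longrightarrow>
        (\<exists>h\<in>mod_hom R P M. \<forall>x\<in>carrier P. g (h x) = f x))"

definition proj_resolution ::
  "('r, 's) ring_scheme \<Rightarrow> (nat \<Rightarrow> 'r fg_module) \<Rightarrow>
    (nat \<Rightarrow> (nat \<Rightarrow> 'r) set \<Rightarrow> (nat \<Rightarrow> 'r) set) \<Rightarrow>
    ((nat \<Rightarrow> 'r) set \<Rightarrow> (nat \<Rightarrow> 'r) set) \<Rightarrow> 'r fg_module \<Rightarrow> bool"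
where
  "proj_resolution R P d \<epsilon> M \<longleftrightarrow>
     (\<forall>i. projective R (P i)) \<and>
     (\<forall>i. d i \<in> mod_hom R (P (Suc i)) (P i)) \<and> \<epsilon> \<in> mod_hom R (P 0) M \<and>
     \<epsilon> ` carrier (P 0) = carrier M \<and>
     d 0 ` carrier (P 1) = a_kernel (P 0) M \<epsilon> \<and>
     (\<forall>i. d (Suc i) ` carrier (P (Suc (Suc i))) = a_kernel (P (Suc i)) (P i) (d i))"

text \<open>\<open>d k\<close> maps \<open>P (Suc k)\<close> to \<open>P k\<close>, so its image is a \<open>Suc k\<close>-th syzygy.\<close>

definition is_syzygy :: "('r, 's) ring_scheme \<Rightarrow> nat \<Rightarrow> 'r fg_module \<Rightarrow> 'r fg_module \<Rightarrow> bool" where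
  "is_syzygy R n M K \<longleftrightarrow> (case n of
     0 \<Rightarrow> mod_iso R K M
   | Suc k \<Rightarrow> \<exists>P d \<epsilon>. proj_resolution R P d \<epsilon> M \<and>
       mod_iso R K ((P k)\<lparr>carrier := d k ` carrier (P (Suc k))\<rparr>))"

definition Omega :: "('r, 's) ring_scheme \<Rightarrow> nat \<Rightarrow> 'r fg_module set" where
  "Omega R n = {K \<in> fg_modules R. \<exists>M\<in>fg_modules R. is_syzygy R n M K}"

end

theory Submission
  imports Defs "HOL-Algebra.Ring_Divisibility"
begin

text \<open>
  Over a commutative Artin ring \<open>R\<close>, localization at a prime \<open>\<pp>\<close> is multiplication by an idempotent:
  the descending chain condition provides an idempotent \<open>e \<notin> \<pp>\<close> divisible by every element outside
  \<open>\<pp>\<close> (\<open>prime_idempotent\<close>), and then \<open>R\<^sub>\<pp> \<cong> eR\<close> (\<open>localization_common_corner\<close>). Localization \<open>X \<mapsto> eX\<close> and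
  restriction of scalars from \<open>R\<^sub>\<pp>\<close> to \<open>R\<close> are two instances of one construction, for two rings \<open>A\<close>
  and \<open>B\<close> with an isomorphism \<open>eA \<cong> e'B\<close> between the corners at idempotents: an \<open>A\<close>-module \<open>X\<close>
  goes to \<open>eX\<close>, regarded as a \<open>B\<close>-module. This functor is additive and exact, and it preserves
  projective modules. So it maps the extension layers \<open>[N]\<^sub>n\<close> of \<open>N\<close> into those of the image of \<open>N\<close>
  (\<open>ext_layer_corner\<close>), and \<open>j\<close>-th syzygies to \<open>j\<close>-th syzygies (\<open>Omega_corner\<close>).

  From \<open>R\<close> to \<open>R\<^sub>\<pp>\<close>: a \<open>j\<close>-th syzygy over \<open>R\<^sub>\<pp>\<close> is one over \<open>R\<close> by restriction of scalars, and is recovered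
  from its restriction by localizing; so a bound over \<open>R\<close> localizes to a bound over \<open>R\<^sub>\<pp>\<close>
  (\<open>ext_dim_Omega_corner\<close>).

  From the maximal ideals to \<open>R\<close>: let \<open>e\<close> be the idempotent found for a maximal ideal \<open>\<mm>\<close>. A bound over \<open>R\<^sub>\<mm>\<close> gives, after
  restriction of scalars, one module \<open>N\<close> over \<open>R\<close> such that \<open>eK \<in> [N]\<^sub>n\<^sub>+\<^sub>1\<close> for all \<open>j\<close>-th syzygies \<open>K\<close>. The
  idempotents with this property are closed under joins, since \<open>(e + f - ef)K\<close> is the direct sum of
  \<open>eK\<close> and a direct summand of \<open>fK\<close> (\<open>corners_bounded_join\<close>). Hence the union of the ideals that they
  generate is an ideal. It lies in no maximal ideal \<open>\<mm>\<close>, as it contains the idempotent belonging to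
  \<open>\<mm>\<close>. Therefore \<open>\<one>\<close> is among these idempotents (\<open>corners_bounded_one\<close>).
\<close>

section \<open>Finitely generated modules\<close>

lemma (in Module.module) submoduleI_smult:
  assumes "T \<subseteq> carrier M" "\<zero>\<^bsub>M\<^esub> \<in> T"
    and "\<And>x y. x \<in> T \<Longrightarrow> y \<in> T \<Longrightarrow> x \<oplus>\<^bsub>M\<^esub> y \<in> T"
    and sm: "\<And>a x. a \<in> carrier R \<Longrightarrow> x \<in> T \<Longrightarrow> a \<odot>\<^bsub>M\<^esub> x \<in> T"
  shows "submodule T R M"
proof (rule submoduleI)
  fix x assume "x \<in> T"
  then have "(\<ominus> \<one>) \<odot>\<^bsub>M\<^esub> x \<in> T" "x \<in> carrier M"
    using assms(1) sm[of "\<ominus> \<one>" x] by auto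
  then show "\<ominus>\<^bsub>M\<^esub> x \<in> T" by (simp add: smult_l_minus)
qed (use assms in auto)

text \<open>
  Stated through submodules, finite generation can be transferred along maps that are linear
  only up to a change of rings, without computing with sums that are reindexed by a map
  that need not be injective.
\<close>

lemma (in Module.module) fin_gen_iff_submodule:
  "fin_gen R M \<longleftrightarrow> (\<exists>S. finite S \<and> S \<subseteq> carrier M \<and>
     (\<forall>T. submodule T R M \<longrightarrow> S \<subseteq> T \<longrightarrow> carrier M \<subseteq> T))"
proof
  assume "fin_gen R M"
  then obtain S where S: "finite S" "S \<subseteq> carrier M"
    and gen: "\<And>x. x \<in> carrier M \<Longrightarrow> \<exists>c\<in>S \<rightarrow> carrier R. x = (\<Oplus>\<^bsub>M\<^esub>s\<in>S. c s \<odot>\<^bsub>M\<^esub> s)"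
    using fin_genE by blast
  have "carrier M \<subseteq> T" if T: "submodule T R M" "S \<subseteq> T" for T
  proof
    interpret T: submodule T R M by fact
    note sub = submoduleE[OF T(1)]
    have "(\<Oplus>\<^bsub>M\<^esub>s\<in>F. c s \<odot>\<^bsub>M\<^esub> s) \<in> T" if "finite F" "F \<subseteq> S" "c \<in> S \<rightarrow> carrier R" for F c
      using that
    proof (induction F)
      case empty
      show ?case using T.one_closed by simp
    next
      case (insert x F)
      then have "c x \<odot>\<^bsub>M\<^esub> x \<in> T" using T(2) sub(4) by auto
      moreover have "(\<Oplus>\<^bsub>M\<^esub>s\<in>insert x F. c s \<odot>\<^bsub>M\<^esub> s) = c x \<odot>\<^bsub>M\<^esub> x \<oplus>\<^bsub>M\<^esub> (\<Oplus>\<^bsub>M\<^esub>s\<in>F. c s \<odot>\<^bsub>M\<^esub> s)"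
        using insert S(2) by (intro finsum_insert) (auto simp: Pi_def subset_iff)
      ultimately show ?case using insert sub(5) by auto
    qed
    then show "x \<in> T" if "x \<in> carrier M" for x using gen[OF that] S(1) by blast
  qed
  with S show "\<exists>S. finite S \<and> S \<subseteq> carrier M \<and>
     (\<forall>T. submodule T R M \<longrightarrow> S \<subseteq> T \<longrightarrow> carrier M \<subseteq> T)" by blast
next
  assume "\<exists>S. finite S \<and> S \<subseteq> carrier M \<and>
     (\<forall>T. submodule T R M \<longrightarrow> S \<subseteq> T \<longrightarrow> carrier M \<subseteq> T)"
  then obtain S where S: "finite S" "S \<subseteq> carrier M"
    and gen: "\<And>T. submodule T R M \<Longrightarrow> S \<subseteq> T \<Longrightarrow> carrier M \<subseteq> T" by blast
  define T where "T = {\<Oplus>\<^bsub>M\<^esub>s\<in>S. c s \<odot>\<^bsub>M\<^esub> s | c. c \<in> S \<rightarrow> carrier R}"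
  have Tc: "T \<subseteq> carrier M" using S(2) by (auto simp: T_def Pi_def intro!: finsum_closed)
  have TI: "(\<Oplus>\<^bsub>M\<^esub>s\<in>S. c s \<odot>\<^bsub>M\<^esub> s) \<in> T" if "c \<in> S \<rightarrow> carrier R" for c
    using that by (auto simp: T_def)
  have "submodule T R M"
  proof (rule submoduleI_smult[OF Tc])
    have "(\<Oplus>\<^bsub>M\<^esub>s\<in>S. \<zero> \<odot>\<^bsub>M\<^esub> s) = \<zero>\<^bsub>M\<^esub>"
      using S(2) by (intro add.finprod_one_eqI) auto
    then show "\<zero>\<^bsub>M\<^esub> \<in> T" using TI[of "\<lambda>_. \<zero>"] by auto
  next
    fix x y assume "x \<in> T" "y \<in> T"
    then obtain c d where c: "c \<in> S \<rightarrow> carrier R" "x = (\<Oplus>\<^bsub>M\<^esub>s\<in>S. c s \<odot>\<^bsub>M\<^esub> s)"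
      and d: "d \<in> S \<rightarrow> carrier R" "y = (\<Oplus>\<^bsub>M\<^esub>s\<in>S. d s \<odot>\<^bsub>M\<^esub> s)" by (auto simp: T_def)
    have "x \<oplus>\<^bsub>M\<^esub> y = (\<Oplus>\<^bsub>M\<^esub>s\<in>S. c s \<odot>\<^bsub>M\<^esub> s \<oplus>\<^bsub>M\<^esub> d s \<odot>\<^bsub>M\<^esub> s)"
      unfolding c d using c(1) d(1) S(2) by (intro finsum_addf[symmetric]) (auto simp: Pi_def)
    also have "\<dots> = (\<Oplus>\<^bsub>M\<^esub>s\<in>S. (c s \<oplus> d s) \<odot>\<^bsub>M\<^esub> s)"
      using c(1) d(1) S(2) by (intro finsum_cong') (auto simp: Pi_def smult_l_distr)
    also have "\<dots> \<in> T" using c(1) d(1) by (intro TI) auto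
    finally show "x \<oplus>\<^bsub>M\<^esub> y \<in> T" .
  next
    fix a x assume a: "a \<in> carrier R" and "x \<in> T"
    then obtain c where c: "c \<in> S \<rightarrow> carrier R" "x = (\<Oplus>\<^bsub>M\<^esub>s\<in>S. c s \<odot>\<^bsub>M\<^esub> s)"
      by (auto simp: T_def)
    have "a \<odot>\<^bsub>M\<^esub> x = (\<Oplus>\<^bsub>M\<^esub>s\<in>S. a \<odot>\<^bsub>M\<^esub> (c s \<odot>\<^bsub>M\<^esub> s))"
      unfolding c using c(1) S a by (intro finsum_smult_ldistr) (auto simp: Pi_def)
    also have "\<dots> = (\<Oplus>\<^bsub>M\<^esub>s\<in>S. (a \<otimes> c s) \<odot>\<^bsub>M\<^esub> s)"
      using c(1) S a by (intro finsum_cong') (auto simp: Pi_def smult_assoc1)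
    also have "\<dots> \<in> T" using c(1) a by (intro TI) auto
    finally show "a \<odot>\<^bsub>M\<^esub> x \<in> T" .
  qed
  moreover have "S \<subseteq> T"
  proof
    fix t assume t: "t \<in> S"
    have "(\<Oplus>\<^bsub>M\<^esub>s\<in>S. (if t = s then \<one> else \<zero>) \<odot>\<^bsub>M\<^esub> s) = (\<Oplus>\<^bsub>M\<^esub>s\<in>S. if t = s then s else \<zero>\<^bsub>M\<^esub>)"
      using S(2) by (intro finsum_cong') (auto simp: Pi_def)
    also have "\<dots> = t" using add.finprod_singleton[OF t S(1), of "\<lambda>s. s"] S(2) by auto
    finally show "t \<in> T" using TI[of "\<lambda>s. if t = s then \<one> else \<zero>"] by auto
  qed
  ultimately have "carrier M = T" using gen Tc by blast
  then show "fin_gen R M" using S by (auto simp: fin_gen_def T_def)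
qed

lemma mod_hom_id: "(\<lambda>x. x) \<in> mod_hom R M M" by (simp add: mod_hom_def)

lemma mod_hom_comp: "f \<in> mod_hom R L M \<Longrightarrow> g \<in> mod_hom R M N \<Longrightarrow> (\<lambda>x. g (f x)) \<in> mod_hom R L N"
  by (auto simp: mod_hom_def Pi_def)

lemma mod_hom_closed: "f \<in> mod_hom R M N \<Longrightarrow> x \<in> carrier M \<Longrightarrow> f x \<in> carrier N"
  and mod_hom_add: "f \<in> mod_hom R M N \<Longrightarrow> x \<in> carrier M \<Longrightarrow> y \<in> carrier M \<Longrightarrow>
    f (x \<oplus>\<^bsub>M\<^esub> y) = f x \<oplus>\<^bsub>N\<^esub> f y"
  and mod_hom_smult: "f \<in> mod_hom R M N \<Longrightarrow> a \<in> carrier R \<Longrightarrow> x \<in> carrier M \<Longrightarrow>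
    f (a \<odot>\<^bsub>M\<^esub> x) = a \<odot>\<^bsub>N\<^esub> f x"
  by (auto simp: mod_hom_def)

lemma mod_hom_zero:
  assumes "Module.module R M" "Module.module R N" "f \<in> mod_hom R M N"
  shows "f \<zero>\<^bsub>M\<^esub> = \<zero>\<^bsub>N\<^esub>"
proof -
  interpret M: Module.module R M by fact
  interpret N: Module.module R N by fact
  have "f (\<zero>\<^bsub>R\<^esub> \<odot>\<^bsub>M\<^esub> \<zero>\<^bsub>M\<^esub>) = \<zero>\<^bsub>R\<^esub> \<odot>\<^bsub>N\<^esub> f \<zero>\<^bsub>M\<^esub>"
    using assms(3) by (intro mod_hom_smult) auto
  then show ?thesis using mod_hom_closed[OF assms(3)] by simp
qed

lemma mod_iso_refl: "mod_iso R M M"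
  unfolding mod_iso_def by (rule bexI[OF _ mod_hom_id]) (simp add: bij_betw_def)

lemma mod_iso_sym:
  assumes M: "Module.module R M" and "mod_iso R M N"
  shows "mod_iso R N M"
proof -
  interpret M: Module.module R M by fact
  obtain h where h: "h \<in> mod_hom R M N" "bij_betw h (carrier M) (carrier N)"
    using assms(2) by (auto simp: mod_iso_def)
  define i where "i = the_inv_into (carrier M) h"
  have bi: "bij_betw i (carrier N) (carrier M)" unfolding i_def by (rule bij_betw_the_inv_into[OF h(2)])
  have ih: "i (h x) = x" if "x \<in> carrier M" for x
    using that h(2) unfolding i_def by (simp add: bij_betw_def the_inv_into_f_f)
  have ex: "\<exists>x\<in>carrier M. y = h x" if "y \<in> carrier N" for y
    using that h(2) by (auto simp: bij_betw_def)
  have "i \<in> mod_hom R N M"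
    unfolding mod_hom_def
  proof (intro CollectI conjI ballI)
    show "i \<in> carrier N \<rightarrow> carrier M" using bi by (auto simp: bij_betw_def)
    fix y y' assume "y \<in> carrier N" "y' \<in> carrier N"
    then obtain x x' where "x \<in> carrier M" "y = h x" "x' \<in> carrier M" "y' = h x'" using ex by blast
    then show "i (y \<oplus>\<^bsub>N\<^esub> y') = i y \<oplus>\<^bsub>M\<^esub> i y'" by (simp add: ih mod_hom_add[OF h(1), symmetric])
  next
    fix a y assume "a \<in> carrier R" "y \<in> carrier N"
    then obtain x where "x \<in> carrier M" "y = h x" using ex by blast
    then show "i (a \<odot>\<^bsub>N\<^esub> y) = a \<odot>\<^bsub>M\<^esub> i y"
      using \<open>a \<in> carrier R\<close> by (simp add: ih mod_hom_smult[OF h(1), symmetric])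
  qed
  with bi show ?thesis by (auto simp: mod_iso_def)
qed

lemma module_mod_dsum:
  assumes X: "Module.module R X" and Y: "Module.module R Y"
  shows "Module.module R (mod_dsum X Y)"
proof -
  interpret X: Module.module R X by fact
  interpret Y: Module.module R Y by fact
  have "\<exists>q\<in>carrier (mod_dsum X Y). q \<oplus>\<^bsub>mod_dsum X Y\<^esub> p = \<zero>\<^bsub>mod_dsum X Y\<^esub>"
    if "p \<in> carrier (mod_dsum X Y)" for p
    using that by (auto intro!: bexI[of _ "(\<ominus>\<^bsub>X\<^esub> fst p, \<ominus>\<^bsub>Y\<^esub> snd p)"] simp: X.M.l_neg Y.M.l_neg)
  then have "abelian_group (mod_dsum X Y)"
    by (intro abelian_groupI) (auto simp: X.M.a_ac Y.M.a_ac)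
  then show ?thesis
    by (intro moduleI X.R.is_cring)
       (auto simp: X.smult_l_distr X.smult_r_distr X.smult_assoc1
         Y.smult_l_distr Y.smult_r_distr Y.smult_assoc1)
qed

lemma fin_gen_mod_dsum:
  assumes X: "Module.module R X" "fin_gen R X" and Y: "Module.module R Y" "fin_gen R Y"
  shows "fin_gen R (mod_dsum X Y)"
proof -
  interpret X: Module.module R X by fact
  interpret Y: Module.module R Y by fact
  interpret D: Module.module R "mod_dsum X Y" by (rule module_mod_dsum) fact+
  obtain S where S: "finite S" "S \<subseteq> carrier X"
    "\<And>T. submodule T R X \<Longrightarrow> S \<subseteq> T \<Longrightarrow> carrier X \<subseteq> T"
    using X(2) X.fin_gen_iff_submodule by blast
  obtain S' where S': "finite S'" "S' \<subseteq> carrier Y"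
    "\<And>T. submodule T R Y \<Longrightarrow> S' \<subseteq> T \<Longrightarrow> carrier Y \<subseteq> T"
    using Y(2) Y.fin_gen_iff_submodule by blast
  let ?S = "(\<lambda>x. (x, \<zero>\<^bsub>Y\<^esub>)) ` S \<union> (\<lambda>y. (\<zero>\<^bsub>X\<^esub>, y)) ` S'"
  have "carrier (mod_dsum X Y) \<subseteq> T" if T: "submodule T R (mod_dsum X Y)" "?S \<subseteq> T" for T
  proof
    interpret T: submodule T R "mod_dsum X Y" by fact
    note sub = D.submoduleE[OF T(1)]
    have z: "(\<zero>\<^bsub>X\<^esub>, \<zero>\<^bsub>Y\<^esub>) \<in> T" using T.one_closed by simp
    have "submodule {x \<in> carrier X. (x, \<zero>\<^bsub>Y\<^esub>) \<in> T} R X"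
      using z sub(4)[of _ "(_, _)"] sub(5)[of "(_, _)" "(_, _)"]
      by (intro X.submoduleI_smult) fastforce+
    then have x: "carrier X \<subseteq> {x \<in> carrier X. (x, \<zero>\<^bsub>Y\<^esub>) \<in> T}"
      using S(2) T(2) by (intro S(3)) auto
    have "submodule {y \<in> carrier Y. (\<zero>\<^bsub>X\<^esub>, y) \<in> T} R Y"
      using z sub(4)[of _ "(_, _)"] sub(5)[of "(_, _)" "(_, _)"]
      by (intro Y.submoduleI_smult) fastforce+
    then have y: "carrier Y \<subseteq> {y \<in> carrier Y. (\<zero>\<^bsub>X\<^esub>, y) \<in> T}"
      using S'(2) T(2) by (intro S'(3)) auto
    fix p assume "p \<in> carrier (mod_dsum X Y)"
    then obtain a b where p: "p = (a, b)" "a \<in> carrier X" "b \<in> carrier Y" by auto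
    then have "(a, \<zero>\<^bsub>Y\<^esub>) \<oplus>\<^bsub>mod_dsum X Y\<^esub> (\<zero>\<^bsub>X\<^esub>, b) \<in> T" using x y by (intro sub(5)) auto
    then show "p \<in> T" using p by simp
  qed
  moreover have "finite ?S" "?S \<subseteq> carrier (mod_dsum X Y)" using S S' by auto
  ultimately show ?thesis unfolding D.fin_gen_iff_submodule by blast
qed

lemma fg_modules_dsum:
  assumes "X \<in> fg_modules R" "Y \<in> fg_modules R"
  shows "\<exists>Z\<in>fg_modules R. mod_iso R Z (mod_dsum X Y)"
proof -
  have m: "Module.module R (mod_dsum X Y)" "fin_gen R (mod_dsum X Y)"
    using assms by (auto simp: fg_modules_def intro: module_mod_dsum fin_gen_mod_dsum)
  then show ?thesis using fg_modules_exhaustive[OF m] mod_iso_sym[OF m(1)] by blast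
qed

lemma fg_modules_zero:
  assumes "cring R"
  shows "\<exists>Z\<in>fg_modules R. carrier Z = {\<zero>\<^bsub>Z\<^esub>}"
proof -
  define Z :: "'a fg_module" where
    "Z = \<lparr>carrier = {{}}, monoid.mult = undefined, one = undefined, zero = {}, add = \<lambda>_ _. {}, smult = \<lambda>_ _. {}\<rparr>"
  have c: "carrier Z = {\<zero>\<^bsub>Z\<^esub>}" by (simp add: Z_def)
  have "abelian_group Z" by (rule abelian_groupI) (auto simp: Z_def)
  then have "Module.module R Z" by (intro moduleI assms) (auto simp: Z_def)
  then interpret Z: Module.module R Z .
  have "fin_gen R Z" unfolding Z.fin_gen_iff_submodule
    using c by (intro exI[of _ "carrier Z"]) auto
  with c \<open>Module.module R Z\<close> show ?thesis by (auto simp: fg_modules_def)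
qed

lemma fg_modulesD:
  assumes "X \<in> fg_modules R"
  shows "Module.module R X" "fin_gen R X"
  using assms by (auto simp: fg_modules_def)

lemma projective_lift:
  assumes "projective R P" "M \<in> fg_modules R" "N \<in> fg_modules R" "g \<in> mod_hom R M N"
    "f \<in> mod_hom R P N" "g ` carrier M = carrier N"
  shows "\<exists>h\<in>mod_hom R P M. \<forall>x\<in>carrier P. g (h x) = f x"
  using assms unfolding projective_def by simp

lemma mod_hom_image_module:
  assumes M: "Module.module R M" and N: "Module.module R N" and f: "f \<in> mod_hom R M N"
  shows "Module.module R (N\<lparr>carrier := f ` carrier M\<rparr>)"
proof -
  interpret M: Module.module R M by fact
  interpret N: Module.module R N by fact
  have "submodule (f ` carrier M) R N"
  proof (rule N.submoduleI_smult)
    show "f ` carrier M \<subseteq> carrier N" using mod_hom_closed[OF f] by auto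
    show "\<zero>\<^bsub>N\<^esub> \<in> f ` carrier M"
      using mod_hom_zero[OF M N f] by (metis M.M.zero_closed image_eqI)
  qed (auto simp flip: mod_hom_add[OF f] mod_hom_smult[OF f])
  then show ?thesis using N by (rule submodule.submodule_is_module)
qed

section \<open>Layers of extensions\<close>

lemma add_closure_fg: "X \<in> add_closure R U \<Longrightarrow> X \<in> fg_modules R"
  by (induction rule: add_closure.induct)

lemma add_closure_least:
  assumes "U \<inter> fg_modules R \<subseteq> add_closure R V"
  shows "add_closure R U \<subseteq> add_closure R V"
proof
  fix X assume "X \<in> add_closure R U"
  then show "X \<in> add_closure R V"
    by induction (use assms in \<open>auto intro: add_closure.intros\<close>)
qed

lemma ext_layer_Suc: "\<exists>W. ext_layer R U (Suc k) = add_closure R W"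
  by (cases k) auto

lemma ext_layer_fg: "X \<in> ext_layer R U (Suc k) \<Longrightarrow> X \<in> fg_modules R"
  using ext_layer_Suc[of R U k] add_closure_fg by metis

text \<open>
  Only the additive closure of the generating class matters.
\<close>

lemma ext_layer_mono:
  assumes "U \<inter> fg_modules R \<subseteq> add_closure R V"
  shows "ext_layer R U (Suc k) \<subseteq> ext_layer R V (Suc k)"
proof (induction k)
  case 0
  show ?case using add_closure_least[OF assms] by simp
next
  case (Suc k)
  have "ext_prod R (ext_layer R U (Suc k)) (add_closure R U)
      \<subseteq> ext_prod R (ext_layer R V (Suc k)) (add_closure R V)"
    using Suc.IH add_closure_least[OF assms] unfolding ext_prod_def by blast
  then have "ext_prod R (ext_layer R U (Suc k)) (add_closure R U) \<inter> fg_modules R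
      \<subseteq> add_closure R (ext_prod R (ext_layer R V (Suc k)) (add_closure R V))"
    by (blast intro: add_closure.base)
  then show ?case using add_closure_least by simp
qed

text \<open>
  Extending a module \<open>X\<close> by the zero module gives \<open>X\<close> again.
\<close>

lemma ext_layer_subset_Suc:
  assumes "cring R"
  shows "ext_layer R U (Suc k) \<subseteq> ext_layer R U (Suc (Suc k))"
proof
  fix X assume X: "X \<in> ext_layer R U (Suc k)"
  then have fg: "X \<in> fg_modules R" by (rule ext_layer_fg)
  obtain Z :: "'a fg_module" where Z: "Z \<in> fg_modules R" "carrier Z = {\<zero>\<^bsub>Z\<^esub>}"
    using fg_modules_zero[OF assms] by blast
  interpret Z: Module.module R Z using Z by (simp add: fg_modules_def)
  interpret X: Module.module R X using fg by (simp add: fg_modules_def)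
  have "short_exact R X (\<lambda>x. x) X (\<lambda>_. \<zero>\<^bsub>Z\<^esub>) Z"
    using Z(2) by (auto simp: short_exact_def mod_hom_def a_kernel_def' image_constant_conv)
  moreover have "Z \<in> add_closure R U" using Z by (rule add_closure.zero)
  ultimately have "X \<in> ext_prod R (ext_layer R U (Suc k)) (add_closure R U)"
    using X fg unfolding ext_prod_def by blast
  then show "X \<in> ext_layer R U (Suc (Suc k))" using fg by (auto intro: add_closure.base)
qed

text \<open>
  An extension dimension at most \<open>n\<close> is attained at some \<open>m \<le> n\<close>, because the infimum of a nonempty set of
  extended natural numbers belongs to the set; the layers increase, so one may take \<open>m = n\<close>.
\<close>

lemma ext_dim_le_iff:
  assumes "cring R"
  shows "ext_dim R U \<le> enat n \<longleftrightarrow> (\<exists>N\<in>fg_modules R. U \<subseteq> ext_layer R {N} (Suc n))"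
proof
  let ?D = "{enat n | n. \<exists>N\<in>fg_modules R. U \<subseteq> ext_layer R {N} (n + 1)}"
  assume le: "ext_dim R U \<le> enat n"
  then have "?D \<noteq> {}" by (auto simp: ext_dim_def Inf_enat_def top_enat_def split: if_splits)
  then have "ext_dim R U \<in> ?D" unfolding ext_dim_def by (rule wellorder_InfI[OF ex_in_conv[THEN iffD2, THEN someI_ex]])
  then obtain m N where m: "ext_dim R U = enat m" "N \<in> fg_modules R" "U \<subseteq> ext_layer R {N} (Suc m)"
    by auto
  have "m \<le> n" using le m(1) by simp
  then have "ext_layer R {N} (Suc m) \<subseteq> ext_layer R {N} (Suc n)"
    by (induction rule: dec_induct) (use ext_layer_subset_Suc[OF assms] in blast)+
  with m show "\<exists>N\<in>fg_modules R. U \<subseteq> ext_layer R {N} (Suc n)" by blast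
next
  assume "\<exists>N\<in>fg_modules R. U \<subseteq> ext_layer R {N} (Suc n)"
  then show "ext_dim R U \<le> enat n" unfolding ext_dim_def by (intro Inf_lower) auto
qed

section \<open>Rings with a common corner\<close>

text \<open>
  If \<open>\<beta>\<close> is multiplicative and additive, \<open>e = \<beta> \<one>\<close> is an idempotent, and \<open>eX\<close> is a \<open>B\<close>-module with
  \<open>b\<close> acting as \<open>\<beta> b\<close>. A corner map is a map \<open>X \<rightarrow> Y\<close> that factors as \<open>x \<mapsto> ex\<close> followed by an
  isomorphism \<open>eX \<cong> Y\<close>. Since carriers of finitely generated modules over \<open>A\<close> and over \<open>B\<close> live on
  different types, no module is singled out as the value of this functor at \<open>X\<close>; it is treated as a
  relation between modules, and its uniqueness up to isomorphism is a lemma.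
\<close>

definition corner_map ::
  "('b, 't) ring_scheme \<Rightarrow> ('b \<Rightarrow> 'a) \<Rightarrow> ('a, 'x, 'c) module_scheme \<Rightarrow> ('b, 'y, 'd) module_scheme \<Rightarrow>
    ('x \<Rightarrow> 'y) \<Rightarrow> bool"
where
  "corner_map B \<beta> X Y h \<longleftrightarrow>
     (\<forall>x\<in>carrier X. \<forall>x'\<in>carrier X. h (x \<oplus>\<^bsub>X\<^esub> x') = h x \<oplus>\<^bsub>Y\<^esub> h x') \<and>
     (\<forall>b\<in>carrier B. \<forall>x\<in>carrier X. h (\<beta> b \<odot>\<^bsub>X\<^esub> x) = b \<odot>\<^bsub>Y\<^esub> h x) \<and>
     h ` carrier X = carrier Y \<and>
     (\<forall>x\<in>carrier X. \<forall>x'\<in>carrier X. h x = h x' \<longrightarrow> \<beta> \<one>\<^bsub>B\<^esub> \<odot>\<^bsub>X\<^esub> x = \<beta> \<one>\<^bsub>B\<^esub> \<odot>\<^bsub>X\<^esub> x')"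

definition is_corner ::
  "('b, 't) ring_scheme \<Rightarrow> ('b \<Rightarrow> 'a) \<Rightarrow> ('a, 'x, 'c) module_scheme \<Rightarrow> ('b, 'y, 'd) module_scheme \<Rightarrow>
    bool"
where
  "is_corner B \<beta> X Y \<longleftrightarrow> (\<exists>h. corner_map B \<beta> X Y h)"

lemma corner_map_add: "corner_map B \<beta> X Y h \<Longrightarrow> x \<in> carrier X \<Longrightarrow> x' \<in> carrier X \<Longrightarrow>
    h (x \<oplus>\<^bsub>X\<^esub> x') = h x \<oplus>\<^bsub>Y\<^esub> h x'"
  and corner_map_smult: "corner_map B \<beta> X Y h \<Longrightarrow> b \<in> carrier B \<Longrightarrow> x \<in> carrier X \<Longrightarrow>
    h (\<beta> b \<odot>\<^bsub>X\<^esub> x) = b \<odot>\<^bsub>Y\<^esub> h x"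
  and corner_map_image: "corner_map B \<beta> X Y h \<Longrightarrow> h ` carrier X = carrier Y"
  and corner_map_eqD: "corner_map B \<beta> X Y h \<Longrightarrow> x \<in> carrier X \<Longrightarrow> x' \<in> carrier X \<Longrightarrow> h x = h x' \<Longrightarrow>
    \<beta> \<one>\<^bsub>B\<^esub> \<odot>\<^bsub>X\<^esub> x = \<beta> \<one>\<^bsub>B\<^esub> \<odot>\<^bsub>X\<^esub> x'"
  unfolding corner_map_def by blast+

lemma corner_map_closed: "corner_map B \<beta> X Y h \<Longrightarrow> x \<in> carrier X \<Longrightarrow> h x \<in> carrier Y"
  by (metis corner_map_image image_eqI)

lemma corner_map_surj:
  assumes "corner_map B \<beta> X Y h" "y \<in> carrier Y"
  obtains x where "x \<in> carrier X" "y = h x"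
  by (metis assms corner_map_image imageE)

text \<open>
  The data amount to idempotents \<open>e = \<beta> \<one>\<close> of \<open>A\<close> and \<open>e' = \<alpha> \<one>\<close> of \<open>B\<close> together with a ring
  isomorphism \<open>eA \<cong> e'B\<close>; neither \<open>\<alpha>\<close> nor \<open>\<beta>\<close> has to preserve the unit. The symmetry lets every
  result be used in both directions. With \<open>B = A\<^sub>\<pp>\<close> and \<open>e' = \<one>\<close>, taking corners along \<open>\<beta>\<close> is localization
  of modules, and taking corners along \<open>\<alpha>\<close> is restriction of scalars to \<open>A\<close>. With \<open>A = B\<close> and both
  maps equal to multiplication by \<open>e\<close>, it is \<open>X \<mapsto> eX\<close>.
\<close>

locale common_corner = A: cring A + B: cring B
  for A :: "('a, 's) ring_scheme" and B :: "('b, 't) ring_scheme" +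
  fixes \<alpha> :: "'a \<Rightarrow> 'b" and \<beta> :: "'b \<Rightarrow> 'a"
  assumes alpha_closed [simp]: "a \<in> carrier A \<Longrightarrow> \<alpha> a \<in> carrier B"
    and beta_closed [simp]: "b \<in> carrier B \<Longrightarrow> \<beta> b \<in> carrier A"
    and alpha_add: "a \<in> carrier A \<Longrightarrow> a' \<in> carrier A \<Longrightarrow> \<alpha> (a \<oplus>\<^bsub>A\<^esub> a') = \<alpha> a \<oplus>\<^bsub>B\<^esub> \<alpha> a'"
    and beta_add: "b \<in> carrier B \<Longrightarrow> b' \<in> carrier B \<Longrightarrow> \<beta> (b \<oplus>\<^bsub>B\<^esub> b') = \<beta> b \<oplus>\<^bsub>A\<^esub> \<beta> b'"
    and alpha_mult: "a \<in> carrier A \<Longrightarrow> a' \<in> carrier A \<Longrightarrow> \<alpha> (a \<otimes>\<^bsub>A\<^esub> a') = \<alpha> a \<otimes>\<^bsub>B\<^esub> \<alpha> a'"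
    and beta_mult: "b \<in> carrier B \<Longrightarrow> b' \<in> carrier B \<Longrightarrow> \<beta> (b \<otimes>\<^bsub>B\<^esub> b') = \<beta> b \<otimes>\<^bsub>A\<^esub> \<beta> b'"
    and beta_alpha: "a \<in> carrier A \<Longrightarrow> \<beta> (\<alpha> a) = \<beta> \<one>\<^bsub>B\<^esub> \<otimes>\<^bsub>A\<^esub> a"
    and alpha_beta: "b \<in> carrier B \<Longrightarrow> \<alpha> (\<beta> b) = \<alpha> \<one>\<^bsub>A\<^esub> \<otimes>\<^bsub>B\<^esub> b"

lemma (in common_corner) flip: "common_corner B A \<beta> \<alpha>"
  by unfold_locales (auto simp: alpha_add beta_add alpha_mult beta_mult alpha_beta beta_alpha)

context common_corner
begin

abbreviation "e \<equiv> \<beta> \<one>\<^bsub>B\<^esub>"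

lemma e_beta: "b \<in> carrier B \<Longrightarrow> e \<otimes>\<^bsub>A\<^esub> \<beta> b = \<beta> b"
  using beta_mult[of "\<one>\<^bsub>B\<^esub>" b] by simp

lemma corner_map_e:
  assumes "Module.module B Y" "corner_map B \<beta> X Y h" "x \<in> carrier X"
  shows "h (e \<odot>\<^bsub>X\<^esub> x) = h x"
  using corner_map_smult[OF assms(2) B.one_closed assms(3)] corner_map_closed[OF assms(2,3)]
    Module.module.smult_one[OF assms(1)] by simp

lemma corner_map_eqI:
  assumes "Module.module B Y" "corner_map B \<beta> X Y h" "x \<in> carrier X" "x' \<in> carrier X"
    and "e \<odot>\<^bsub>X\<^esub> x = e \<odot>\<^bsub>X\<^esub> x'"
  shows "h x = h x'"
  using corner_map_e[OF assms(1,2)] assms(3-5) by metis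

lemma corner_map_zero:
  assumes "Module.module A X" "Module.module B Y" "corner_map B \<beta> X Y h"
  shows "h \<zero>\<^bsub>X\<^esub> = \<zero>\<^bsub>Y\<^esub>"
proof -
  interpret X: Module.module A X by fact
  interpret Y: Module.module B Y by fact
  show ?thesis
    using corner_map_smult[OF assms(3), of "\<zero>\<^bsub>B\<^esub>" "\<zero>\<^bsub>X\<^esub>"] corner_map_closed[OF assms(3)] by simp
qed

lemma corner_iso_comp:
  assumes "Module.module A X" "mod_iso A X X'" "is_corner B \<beta> X' Y"
  shows "is_corner B \<beta> X Y"
proof -
  interpret X: Module.module A X by fact
  obtain f where f: "f \<in> mod_hom A X X'" "bij_betw f (carrier X) (carrier X')"
    using assms(2) by (auto simp: mod_iso_def)
  obtain h where h: "corner_map B \<beta> X' Y h" using assms(3) by (auto simp: is_corner_def)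
  have im: "f ` carrier X = carrier X'" and inj: "inj_on f (carrier X)"
    using f(2) by (auto simp: bij_betw_def)
  have "corner_map B \<beta> X Y (\<lambda>x. h (f x))"
    unfolding corner_map_def
  proof (intro conjI ballI impI)
    show "(\<lambda>x. h (f x)) ` carrier X = carrier Y"
      using image_image[of h f "carrier X"] im corner_map_image[OF h] by simp
    fix x x' assume x: "x \<in> carrier X" "x' \<in> carrier X" "h (f x) = h (f x')"
    then have "e \<odot>\<^bsub>X'\<^esub> f x = e \<odot>\<^bsub>X'\<^esub> f x'"
      by (intro corner_map_eqD[OF h] mod_hom_closed[OF f(1)])
    then have "f (e \<odot>\<^bsub>X\<^esub> x) = f (e \<odot>\<^bsub>X\<^esub> x')" using x by (simp add: mod_hom_smult[OF f(1)])
    then show "e \<odot>\<^bsub>X\<^esub> x = e \<odot>\<^bsub>X\<^esub> x'" using x by (auto dest: inj_onD[OF inj])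
  qed (simp_all add: mod_hom_add[OF f(1)] mod_hom_smult[OF f(1)] mod_hom_closed[OF f(1)]
      corner_map_add[OF h] corner_map_smult[OF h])
  then show ?thesis by (auto simp: is_corner_def)
qed

text \<open>
  The module \<open>eX\<close> itself, moved to the carrier type of the finitely generated \<open>B\<close>-modules. If \<open>S\<close>
  generates \<open>X\<close>, then \<open>eS\<close> generates \<open>eX\<close> over \<open>B\<close>, because \<open>e(ax) = \<alpha> a\<cdot>ex\<close>.
\<close>

lemma corner_exists:
  fixes X :: "('a, 'x, 'c) module_scheme"
  assumes X: "Module.module A X" "fin_gen A X"
  shows "\<exists>Y\<in>fg_modules B. is_corner B \<beta> X Y"
proof -
  interpret X: Module.module A X by fact
  define E :: "('b, 'x) module" where
    "E = \<lparr>carrier = (\<lambda>x. e \<odot>\<^bsub>X\<^esub> x) ` carrier X, monoid.mult = undefined, one = undefined,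
      zero = \<zero>\<^bsub>X\<^esub>, add = (\<oplus>\<^bsub>X\<^esub>), smult = (\<lambda>b x. \<beta> b \<odot>\<^bsub>X\<^esub> x)\<rparr>"
  have E [simp]: "carrier E = (\<lambda>x. e \<odot>\<^bsub>X\<^esub> x) ` carrier X" "\<zero>\<^bsub>E\<^esub> = \<zero>\<^bsub>X\<^esub>"
    "x \<oplus>\<^bsub>E\<^esub> y = x \<oplus>\<^bsub>X\<^esub> y" "b \<odot>\<^bsub>E\<^esub> x = \<beta> b \<odot>\<^bsub>X\<^esub> x" for x y b
    by (simp_all add: E_def)
  have be: "\<beta> b \<odot>\<^bsub>X\<^esub> (e \<odot>\<^bsub>X\<^esub> x) = \<beta> b \<odot>\<^bsub>X\<^esub> x" "e \<odot>\<^bsub>X\<^esub> (\<beta> b \<odot>\<^bsub>X\<^esub> x) = \<beta> b \<odot>\<^bsub>X\<^esub> x"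
    if "b \<in> carrier B" "x \<in> carrier X" for b x
    using that e_beta[OF that(1)] A.m_comm[of "\<beta> b" e] by (simp_all flip: X.smult_assoc1)
  have Eadd: "e \<odot>\<^bsub>X\<^esub> x \<oplus>\<^bsub>X\<^esub> e \<odot>\<^bsub>X\<^esub> y \<in> carrier E" if "x \<in> carrier X" "y \<in> carrier X" for x y
    using that by (auto simp flip: X.smult_r_distr)
  have Esm: "\<beta> b \<odot>\<^bsub>X\<^esub> x \<in> carrier E" if "b \<in> carrier B" "x \<in> carrier X" for b x
    using be(2)[OF that, symmetric] that by auto
  have Ez: "\<zero>\<^bsub>X\<^esub> \<in> carrier E" using Esm[of "\<one>\<^bsub>B\<^esub>" "\<zero>\<^bsub>X\<^esub>"] by simp
  have Eneg: "\<exists>y\<in>carrier E. y \<oplus>\<^bsub>X\<^esub> e \<odot>\<^bsub>X\<^esub> x = \<zero>\<^bsub>X\<^esub>" if "x \<in> carrier X" for x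
    using that by (intro bexI[of _ "e \<odot>\<^bsub>X\<^esub> (\<ominus>\<^bsub>X\<^esub> x)"]) (auto simp: X.M.l_neg simp flip: X.smult_r_distr)
  have "abelian_group E"
    using Eadd Ez Eneg by (intro abelian_groupI) (auto simp: X.M.a_ac)
  then have mE: "Module.module B E"
    using Esm by (intro moduleI B.is_cring)
      (auto simp: beta_add beta_mult X.smult_l_distr X.smult_r_distr X.smult_assoc1 be)
  interpret EM: Module.module B E by (rule mE)
  have fgE: "fin_gen B E"
  proof -
    obtain S where S: "finite S" "S \<subseteq> carrier X"
      "\<And>T. submodule T A X \<Longrightarrow> S \<subseteq> T \<Longrightarrow> carrier X \<subseteq> T"
      using X(2) X.fin_gen_iff_submodule by blast
    have "carrier E \<subseteq> T" if T: "submodule T B E" "(\<lambda>x. e \<odot>\<^bsub>X\<^esub> x) ` S \<subseteq> T" for T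
    proof -
      interpret T: submodule T B E by fact
      note sub = EM.submoduleE[OF T(1)]
      have z: "\<zero>\<^bsub>X\<^esub> \<in> T" using T.one_closed by simp
      have "submodule {x \<in> carrier X. e \<odot>\<^bsub>X\<^esub> x \<in> T} A X"
      proof (rule X.submoduleI_smult)
        fix x y assume "x \<in> {x \<in> carrier X. e \<odot>\<^bsub>X\<^esub> x \<in> T}" "y \<in> {x \<in> carrier X. e \<odot>\<^bsub>X\<^esub> x \<in> T}"
        then show "x \<oplus>\<^bsub>X\<^esub> y \<in> {x \<in> carrier X. e \<odot>\<^bsub>X\<^esub> x \<in> T}"
          using sub(5)[of "e \<odot>\<^bsub>X\<^esub> x" "e \<odot>\<^bsub>X\<^esub> y"] by (auto simp: X.smult_r_distr)
      next
        fix a x assume a: "a \<in> carrier A" and x: "x \<in> {x \<in> carrier X. e \<odot>\<^bsub>X\<^esub> x \<in> T}"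
        have "e \<odot>\<^bsub>X\<^esub> (a \<odot>\<^bsub>X\<^esub> x) = \<alpha> a \<odot>\<^bsub>E\<^esub> (e \<odot>\<^bsub>X\<^esub> x)"
          using a x A.m_comm[of a e] be(1)[of "\<one>\<^bsub>B\<^esub>" x] be(1)[of "\<alpha> a" x]
          by (simp add: beta_alpha X.smult_assoc1)
        also have "\<dots> \<in> T" using a x by (intro sub(4)) auto
        finally show "a \<odot>\<^bsub>X\<^esub> x \<in> {x \<in> carrier X. e \<odot>\<^bsub>X\<^esub> x \<in> T}" using a x by auto
      qed (use z in auto)
      then have "carrier X \<subseteq> {x \<in> carrier X. e \<odot>\<^bsub>X\<^esub> x \<in> T}" using T(2) S(2) by (intro S(3)) auto
      then show ?thesis by auto
    qed
    then show ?thesis unfolding EM.fin_gen_iff_submodule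
      using S(1,2) by (intro exI[of _ "(\<lambda>x. e \<odot>\<^bsub>X\<^esub> x) ` S"]) auto
  qed
  have h: "corner_map B \<beta> X E (\<lambda>x. e \<odot>\<^bsub>X\<^esub> x)"
    by (auto simp: corner_map_def X.smult_r_distr be)
  obtain Y where Y: "Y \<in> fg_modules B" "mod_iso B E Y"
    using fg_modules_exhaustive[OF mE fgE] by blast
  then obtain f where f: "f \<in> mod_hom B E Y" "bij_betw f (carrier E) (carrier Y)"
    by (auto simp: mod_iso_def)
  have "corner_map B \<beta> X Y (\<lambda>x. f (e \<odot>\<^bsub>X\<^esub> x))"
    unfolding corner_map_def
  proof (intro conjI ballI impI)
    fix x x' assume x: "x \<in> carrier X" "x' \<in> carrier X"
    show "f (e \<odot>\<^bsub>X\<^esub> (x \<oplus>\<^bsub>X\<^esub> x')) = f (e \<odot>\<^bsub>X\<^esub> x) \<oplus>\<^bsub>Y\<^esub> f (e \<odot>\<^bsub>X\<^esub> x')"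
      using x mod_hom_add[OF f(1), of "e \<odot>\<^bsub>X\<^esub> x" "e \<odot>\<^bsub>X\<^esub> x'"] by (simp add: X.smult_r_distr)
    assume "f (e \<odot>\<^bsub>X\<^esub> x) = f (e \<odot>\<^bsub>X\<^esub> x')"
    then show "e \<odot>\<^bsub>X\<^esub> x = e \<odot>\<^bsub>X\<^esub> x'"
      using f(2) x by (auto simp: bij_betw_def dest: inj_onD)
  next
    fix b x assume b: "b \<in> carrier B" "x \<in> carrier X"
    show "f (e \<odot>\<^bsub>X\<^esub> (\<beta> b \<odot>\<^bsub>X\<^esub> x)) = b \<odot>\<^bsub>Y\<^esub> f (e \<odot>\<^bsub>X\<^esub> x)"
      using b mod_hom_smult[OF f(1), of b "e \<odot>\<^bsub>X\<^esub> x"] by (simp add: be)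
  next
    show "(\<lambda>x. f (e \<odot>\<^bsub>X\<^esub> x)) ` carrier X = carrier Y"
      using f(2) by (simp add: bij_betw_def image_image)
  qed
  with Y(1) show ?thesis by (auto simp: is_corner_def)
qed

text \<open>
  Universal property: for a \<open>B\<close>-module \<open>Z\<close>, maps \<open>t\<close> that satisfy the linearity conditions of a corner
  map factor through \<open>h\<close>. Indeed \<open>t x = \<one>\<cdot>t x = t (ex)\<close>, and \<open>h x\<close> determines \<open>ex\<close>.
\<close>

lemma corner_map_factor:
  assumes X: "Module.module A X" and Z: "Module.module B Z" and h: "corner_map B \<beta> X Y h"
    and closed: "\<And>x. x \<in> carrier X \<Longrightarrow> t x \<in> carrier Z"
    and add: "\<And>x x'. x \<in> carrier X \<Longrightarrow> x' \<in> carrier X \<Longrightarrow> t (x \<oplus>\<^bsub>X\<^esub> x') = t x \<oplus>\<^bsub>Z\<^esub> t x'"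
    and smult: "\<And>b x. b \<in> carrier B \<Longrightarrow> x \<in> carrier X \<Longrightarrow> t (\<beta> b \<odot>\<^bsub>X\<^esub> x) = b \<odot>\<^bsub>Z\<^esub> t x"
  obtains g where "g \<in> mod_hom B Y Z" "\<And>x. x \<in> carrier X \<Longrightarrow> g (h x) = t x"
proof -
  interpret X: Module.module A X by fact
  interpret Z: Module.module B Z by fact
  define g where "g y = t (SOME x. x \<in> carrier X \<and> h x = y)" for y
  have te: "t (e \<odot>\<^bsub>X\<^esub> x) = t x" if "x \<in> carrier X" for x
    using smult[of "\<one>\<^bsub>B\<^esub>" x] closed that by simp
  have g: "g (h x) = t x" if x: "x \<in> carrier X" for x
  proof -
    define x' where "x' = (SOME x'. x' \<in> carrier X \<and> h x' = h x)"
    have x': "x' \<in> carrier X" "h x' = h x"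
      using someI[of "\<lambda>x'. x' \<in> carrier X \<and> h x' = h x" x] x by (auto simp: x'_def)
    have "t x' = t x" using corner_map_eqD[OF h x'(1) x x'(2)] te x x'(1) by metis
    then show ?thesis by (simp add: g_def x'_def)
  qed
  have "g \<in> mod_hom B Y Z"
    unfolding mod_hom_def
  proof (intro CollectI conjI ballI)
    show "g \<in> carrier Y \<rightarrow> carrier Z"
      by (auto elim!: corner_map_surj[OF h] simp: g closed)
    fix y y' assume "y \<in> carrier Y" "y' \<in> carrier Y"
    then obtain x x' where x: "x \<in> carrier X" "y = h x" "x' \<in> carrier X" "y' = h x'"
      by (metis corner_map_surj[OF h])
    have "g (h (x \<oplus>\<^bsub>X\<^esub> x')) = g y \<oplus>\<^bsub>Z\<^esub> g y'" using x by (subst g) (simp_all add: g add)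
    then show "g (y \<oplus>\<^bsub>Y\<^esub> y') = g y \<oplus>\<^bsub>Z\<^esub> g y'" using x by (simp add: corner_map_add[OF h])
  next
    fix b y assume b: "b \<in> carrier B" and "y \<in> carrier Y"
    then obtain x where x: "x \<in> carrier X" "y = h x" by (metis corner_map_surj[OF h])
    have "g (h (\<beta> b \<odot>\<^bsub>X\<^esub> x)) = b \<odot>\<^bsub>Z\<^esub> g y" using x b by (subst g) (simp_all add: g smult)
    then show "g (b \<odot>\<^bsub>Y\<^esub> y) = b \<odot>\<^bsub>Z\<^esub> g y" using x b by (simp add: corner_map_smult[OF h])
  qed
  then show thesis using g by (rule that)
qed

text \<open>
  The action of the functor on morphisms.
\<close>

lemma corner_map_descend:
  assumes X: "Module.module A X" and Y': "Module.module B Y'"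
    and f: "f \<in> mod_hom A X X'" and h: "corner_map B \<beta> X Y h" and h': "corner_map B \<beta> X' Y' h'"
  obtains g where "g \<in> mod_hom B Y Y'" "\<And>x. x \<in> carrier X \<Longrightarrow> g (h x) = h' (f x)"
proof (rule corner_map_factor[OF X Y' h])
  show "h' (f x) \<in> carrier Y'" if "x \<in> carrier X" for x
    using that by (simp add: corner_map_closed[OF h'] mod_hom_closed[OF f])
  show "h' (f (x \<oplus>\<^bsub>X\<^esub> x')) = h' (f x) \<oplus>\<^bsub>Y'\<^esub> h' (f x')" if "x \<in> carrier X" "x' \<in> carrier X" for x x'
    using that by (simp add: mod_hom_add[OF f] corner_map_add[OF h'] mod_hom_closed[OF f])
  show "h' (f (\<beta> b \<odot>\<^bsub>X\<^esub> x)) = b \<odot>\<^bsub>Y'\<^esub> h' (f x)" if "b \<in> carrier B" "x \<in> carrier X" for b x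
    using that by (simp add: mod_hom_smult[OF f] corner_map_smult[OF h'] mod_hom_closed[OF f])
qed (rule that)

lemma corner_unique:
  assumes X: "Module.module A X" and Y: "Module.module B Y" and Y': "Module.module B Y'"
    and "is_corner B \<beta> X Y" "is_corner B \<beta> X Y'"
  shows "mod_iso B Y Y'"
proof -
  obtain h h' where h: "corner_map B \<beta> X Y h" and h': "corner_map B \<beta> X Y' h'"
    using assms by (auto simp: is_corner_def)
  obtain g where g: "g \<in> mod_hom B Y Y'" "\<And>x. x \<in> carrier X \<Longrightarrow> g (h x) = h' x"
    using corner_map_descend[OF X Y' mod_hom_id h h'] by blast
  have "inj_on g (carrier Y)"
  proof (rule inj_onI)
    fix y y' assume y: "y \<in> carrier Y" "y' \<in> carrier Y" "g y = g y'"
    obtain x where x: "x \<in> carrier X" "y = h x" using y(1) by (rule corner_map_surj[OF h])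
    obtain x' where x': "x' \<in> carrier X" "y' = h x'" using y(2) by (rule corner_map_surj[OF h])
    have "h' x = h' x'" using y(3) x x' by (simp add: g(2))
    then show "y = y'"
      unfolding x(2) x'(2) by (intro corner_map_eqI[OF Y h x(1) x'(1)] corner_map_eqD[OF h' x(1) x'(1)])
  qed
  moreover have "g ` carrier Y = carrier Y'"
    using g(2) by (simp add: image_image flip: corner_map_image[OF h] corner_map_image[OF h'])
  ultimately show ?thesis using g(1) by (auto simp: mod_iso_def bij_betw_def)
qed

lemma corner_mod_dsum:
  assumes "Module.module A X" "Module.module A X'"
    and Y: "Module.module B Y" and Y': "Module.module B Y'"
    and "is_corner B \<beta> X Y" "is_corner B \<beta> X' Y'"
  shows "is_corner B \<beta> (mod_dsum X X') (mod_dsum Y Y')"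
proof -
  obtain h h' where h: "corner_map B \<beta> X Y h" and h': "corner_map B \<beta> X' Y' h'"
    using assms by (auto simp: is_corner_def)
  have "corner_map B \<beta> (mod_dsum X X') (mod_dsum Y Y') (\<lambda>(x, x'). (h x, h' x'))"
    unfolding corner_map_def
  proof (intro conjI)
    show "(\<lambda>(x, x'). (h x, h' x')) ` carrier (mod_dsum X X') = carrier (mod_dsum Y Y')"
      using map_prod_surj_on[OF corner_map_image[OF h] corner_map_image[OF h']] by (simp add: map_prod_def)
    have "\<beta> \<one>\<^bsub>B\<^esub> \<odot>\<^bsub>mod_dsum X X'\<^esub> p = \<beta> \<one>\<^bsub>B\<^esub> \<odot>\<^bsub>mod_dsum X X'\<^esub> q"
      if "p \<in> carrier (mod_dsum X X')" "q \<in> carrier (mod_dsum X X')"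
        "(case p of (x, x') \<Rightarrow> (h x, h' x')) = (case q of (x, x') \<Rightarrow> (h x, h' x'))" for p q
    proof -
      obtain x x' y y' where p: "p = (x, x')" "q = (y, y')" by (metis surj_pair)
      then have "e \<odot>\<^bsub>X\<^esub> x = e \<odot>\<^bsub>X\<^esub> y" "e \<odot>\<^bsub>X'\<^esub> x' = e \<odot>\<^bsub>X'\<^esub> y'"
        using that corner_map_eqD[OF h, of x y] corner_map_eqD[OF h', of x' y'] by simp_all
      with p show ?thesis by simp
    qed
    then show "\<forall>p\<in>carrier (mod_dsum X X'). \<forall>q\<in>carrier (mod_dsum X X').
        (case p of (x, x') \<Rightarrow> (h x, h' x')) = (case q of (x, x') \<Rightarrow> (h x, h' x')) \<longrightarrow>
        \<beta> \<one>\<^bsub>B\<^esub> \<odot>\<^bsub>mod_dsum X X'\<^esub> p = \<beta> \<one>\<^bsub>B\<^esub> \<odot>\<^bsub>mod_dsum X X'\<^esub> q" by blast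
  qed (simp_all add: corner_map_add[OF h] corner_map_smult[OF h] corner_map_add[OF h'] corner_map_smult[OF h'])
  then show ?thesis by (auto simp: is_corner_def)
qed

text \<open>
  The functor is exact: if \<open>h' x'\<close> is sent to zero, then \<open>f' (ex') = e f' x'\<close> vanishes, so \<open>ex'\<close> comes from
  \<open>X\<close>, and \<open>h' x' = h' (ex')\<close>.
\<close>

lemma corner_exact:
  assumes X': "Module.module A X'" and X'': "Module.module A X''"
    and Y': "Module.module B Y'" and Y'': "Module.module B Y''"
    and f': "f' \<in> mod_hom A X' X''"
    and exact: "f ` carrier X = a_kernel X' X'' f'"
    and h: "corner_map B \<beta> X Y h" and h': "corner_map B \<beta> X' Y' h'" and h'': "corner_map B \<beta> X'' Y'' h''"
    and g: "\<And>x. x \<in> carrier X \<Longrightarrow> g (h x) = h' (f x)"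
    and g': "\<And>x. x \<in> carrier X' \<Longrightarrow> g' (h' x) = h'' (f' x)"
  shows "g ` carrier Y = a_kernel Y' Y'' g'"
proof (intro equalityI subsetI)
  interpret X': Module.module A X' by fact
  interpret X'': Module.module A X'' by fact
  {
    fix y assume "y \<in> g ` carrier Y"
    then obtain x where x: "x \<in> carrier X" "y = h' (f x)"
      using g corner_map_image[OF h] by force
    have "f x \<in> a_kernel X' X'' f'" using x exact by blast
    then have "f x \<in> carrier X'" "g' (h' (f x)) = \<zero>\<^bsub>Y''\<^esub>"
      by (auto simp: a_kernel_def' g' corner_map_zero[OF X'' Y'' h''])
    then show "y \<in> a_kernel Y' Y'' g'" unfolding x(2)
      by (simp add: a_kernel_def' corner_map_closed[OF h'])
  }
  fix y assume "y \<in> a_kernel Y' Y'' g'"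
  then have y: "y \<in> carrier Y'" "g' y = \<zero>\<^bsub>Y''\<^esub>" by (auto simp: a_kernel_def')
  obtain x' where x': "x' \<in> carrier X'" "y = h' x'" using y(1) by (rule corner_map_surj[OF h'])
  have fx: "f' x' \<in> carrier X''" using x'(1) by (rule mod_hom_closed[OF f'])
  have "h'' (f' x') = h'' \<zero>\<^bsub>X''\<^esub>" using y(2) x' by (simp add: g' corner_map_zero[OF X'' Y'' h''])
  then have "e \<odot>\<^bsub>X''\<^esub> f' x' = e \<odot>\<^bsub>X''\<^esub> \<zero>\<^bsub>X''\<^esub>" using fx by (intro corner_map_eqD[OF h'']) auto
  then have "f' (e \<odot>\<^bsub>X'\<^esub> x') = \<zero>\<^bsub>X''\<^esub>" using x'(1) by (simp add: mod_hom_smult[OF f'])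
  then have "e \<odot>\<^bsub>X'\<^esub> x' \<in> f ` carrier X" unfolding exact using x'(1) by (simp add: a_kernel_def')
  then obtain x where x: "x \<in> carrier X" "e \<odot>\<^bsub>X'\<^esub> x' = f x" by blast
  have "y = g (h x)" using x x' corner_map_e[OF Y' h' x'(1)] by (simp add: g)
  then show "y \<in> g ` carrier Y" using x(1) by (simp add: corner_map_closed[OF h])
qed

end

section \<open>Layers and syzygies of corners\<close>

context common_corner
begin

lemma corner_map_alpha:
  assumes "Module.module A X" "Module.module B Y" "corner_map B \<beta> X Y h" "a \<in> carrier A" "x \<in> carrier X"
  shows "h (a \<odot>\<^bsub>X\<^esub> x) = \<alpha> a \<odot>\<^bsub>Y\<^esub> h x"
proof -
  interpret X: Module.module A X by fact
  have "h (a \<odot>\<^bsub>X\<^esub> x) = h (e \<odot>\<^bsub>X\<^esub> (a \<odot>\<^bsub>X\<^esub> x))"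
    using assms by (simp add: corner_map_e[OF assms(2,3)])
  also have "\<dots> = h (\<beta> (\<alpha> a) \<odot>\<^bsub>X\<^esub> x)" using assms(4,5) by (simp add: beta_alpha X.smult_assoc1)
  also have "\<dots> = \<alpha> a \<odot>\<^bsub>Y\<^esub> h x" using assms(4,5) by (simp add: corner_map_smult[OF assms(3)])
  finally show ?thesis .
qed

text \<open>
  Taking corners has a right adjoint, namely taking corners in the opposite direction, and that
  functor is exact; hence projectivity is preserved. Concretely, a lifting problem \<open>Q \<rightarrow> N \<leftarrow> M\<close> over
  \<open>B\<close> is turned into the problem \<open>P \<rightarrow> N' \<leftarrow> M'\<close> over \<open>A\<close>, where \<open>M'\<close> and \<open>N'\<close> are corners of \<open>M\<close> and
  \<open>N\<close>. A solution \<open>g': P \<rightarrow> M'\<close> is followed by the inclusion of \<open>M' \<cong> e'M\<close> in \<open>M\<close>, and the composite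
  factors through \<open>Q\<close>.
\<close>

lemma corner_projective:
  assumes P: "projective A P" and Q: "Q \<in> fg_modules B" and h: "corner_map B \<beta> P Q h"
  shows "projective B Q"
  unfolding projective_def
proof (intro conjI ballI impI)
  interpret F: common_corner B A \<beta> \<alpha> by (rule flip)
  have mP: "Module.module A P" and mQ: "Module.module B Q"
    using P Q fg_modulesD(1) unfolding projective_def by blast+
  interpret P: Module.module A P by fact
  interpret Q: Module.module B Q by fact
  fix M N p f
  assume M: "M \<in> fg_modules B" and N: "N \<in> fg_modules B" and p: "p \<in> mod_hom B M N"
    and f: "f \<in> mod_hom B Q N" and surj: "p ` carrier M = carrier N"
  note mM = fg_modulesD(1)[OF M] and mN = fg_modulesD(1)[OF N]
  interpret M: Module.module B M by (rule mM)
  interpret N: Module.module B N by (rule mN)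
  obtain M' u where M': "M' \<in> fg_modules A" and u: "corner_map A \<alpha> M M' u"
    using F.corner_exists[OF fg_modulesD[OF M]] by (auto simp: is_corner_def)
  obtain N' v where N': "N' \<in> fg_modules A" and v: "corner_map A \<alpha> N N' v"
    using F.corner_exists[OF fg_modulesD[OF N]] by (auto simp: is_corner_def)
  note mM' = fg_modulesD(1)[OF M'] and mN' = fg_modulesD(1)[OF N']
  interpret M': Module.module A M' by (rule mM')
  obtain p' where p': "p' \<in> mod_hom A M' N'" "\<And>x. x \<in> carrier M \<Longrightarrow> p' (u x) = v (p x)"
    using F.corner_map_descend[OF mM mN' p u v] by blast
  have surj': "p' ` carrier M' = carrier N'"
  proof -
    have "p' ` carrier M' = v ` p ` carrier M"
      using p'(2) by (simp add: image_image flip: corner_map_image[OF u])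
    then show ?thesis using surj corner_map_image[OF v] by simp
  qed
  have "(\<lambda>x. v (f (h x))) \<in> mod_hom A P N'"
    unfolding mod_hom_def
  proof (intro CollectI conjI ballI)
    fix a x assume "a \<in> carrier A" "x \<in> carrier P"
    then show "v (f (h (a \<odot>\<^bsub>P\<^esub> x))) = a \<odot>\<^bsub>N'\<^esub> v (f (h x))"
      by (simp add: corner_map_alpha[OF mP mQ h] mod_hom_smult[OF f] corner_map_smult[OF v]
        corner_map_closed[OF h] mod_hom_closed[OF f])
  qed (auto simp: corner_map_add[OF h] mod_hom_add[OF f] corner_map_add[OF v]
        corner_map_closed[OF h] corner_map_closed[OF v] mod_hom_closed[OF f])
  then obtain g' where g': "g' \<in> mod_hom A P M'" "\<And>x. x \<in> carrier P \<Longrightarrow> p' (g' x) = v (f (h x))"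
    using projective_lift[OF P M' N' p'(1) _ surj'] by blast
  \<comment> \<open>\<open>u m\<close> determines \<open>e'm\<close>, so \<open>t\<close> is \<open>g'\<close> followed by the embedding of \<open>M'\<close> in \<open>M\<close> with image \<open>e'M\<close>.\<close>
  define t where "t x = \<alpha> \<one>\<^bsub>A\<^esub> \<odot>\<^bsub>M\<^esub> (SOME m. m \<in> carrier M \<and> u m = g' x)" for x
  have t: "t x = \<alpha> \<one>\<^bsub>A\<^esub> \<odot>\<^bsub>M\<^esub> m" if "m \<in> carrier M" "g' x = u m" for x m
    unfolding t_def
  proof (rule someI2[of _ m])
    fix m' assume "m' \<in> carrier M \<and> u m' = g' x"
    with that show "\<alpha> \<one>\<^bsub>A\<^esub> \<odot>\<^bsub>M\<^esub> m' = \<alpha> \<one>\<^bsub>A\<^esub> \<odot>\<^bsub>M\<^esub> m" by (intro corner_map_eqD[OF u]) simp_all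
  qed (use that in simp)
  have ex: thesis if "x \<in> carrier P" and "\<And>m. m \<in> carrier M \<Longrightarrow> g' x = u m \<Longrightarrow> thesis" for x thesis
    using mod_hom_closed[OF g'(1) that(1)] by (rule corner_map_surj[OF u]) (rule that(2))
  have t_closed: "t x \<in> carrier M" if "x \<in> carrier P" for x
  proof -
    obtain m where m: "m \<in> carrier M" "g' x = u m" using \<open>x \<in> carrier P\<close> by (rule ex)
    then show ?thesis using t[OF m] by simp
  qed
  have t_add: "t (x \<oplus>\<^bsub>P\<^esub> x') = t x \<oplus>\<^bsub>M\<^esub> t x'" if x: "x \<in> carrier P" "x' \<in> carrier P" for x x'
  proof -
    obtain m where m: "m \<in> carrier M" "g' x = u m" using x(1) by (rule ex)
    obtain m' where m': "m' \<in> carrier M" "g' x' = u m'" using x(2) by (rule ex)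
    have "g' (x \<oplus>\<^bsub>P\<^esub> x') = u (m \<oplus>\<^bsub>M\<^esub> m')"
      using m m' x by (simp add: mod_hom_add[OF g'(1)] corner_map_add[OF u])
    then have "t (x \<oplus>\<^bsub>P\<^esub> x') = \<alpha> \<one>\<^bsub>A\<^esub> \<odot>\<^bsub>M\<^esub> (m \<oplus>\<^bsub>M\<^esub> m')" using m(1) m'(1) by (intro t) simp_all
    then show ?thesis using m(1) m'(1) t[OF m] t[OF m'] by (simp add: M.smult_r_distr)
  qed
  have t_smult: "t (\<beta> b \<odot>\<^bsub>P\<^esub> x) = b \<odot>\<^bsub>M\<^esub> t x" if b: "b \<in> carrier B" and x: "x \<in> carrier P" for b x
  proof -
    obtain m where m: "m \<in> carrier M" "g' x = u m" using x by (rule ex)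
    have "g' (\<beta> b \<odot>\<^bsub>P\<^esub> x) = u (\<alpha> (\<beta> b) \<odot>\<^bsub>M\<^esub> m)"
      using m b x by (simp add: mod_hom_smult[OF g'(1)] corner_map_smult[OF u])
    then have "t (\<beta> b \<odot>\<^bsub>P\<^esub> x) = \<alpha> \<one>\<^bsub>A\<^esub> \<odot>\<^bsub>M\<^esub> (\<alpha> (\<beta> b) \<odot>\<^bsub>M\<^esub> m)" using m b by (intro t) auto
    also have "\<dots> = (b \<otimes>\<^bsub>B\<^esub> \<alpha> \<one>\<^bsub>A\<^esub>) \<odot>\<^bsub>M\<^esub> m"
      using m b F.e_beta[of "\<beta> b"] by (simp add: alpha_beta B.m_comm flip: M.smult_assoc1)
    also have "\<dots> = b \<odot>\<^bsub>M\<^esub> t x" using m b t[OF m] by (simp add: M.smult_assoc1)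
    finally show ?thesis .
  qed
  obtain g where g: "g \<in> mod_hom B Q M" "\<And>x. x \<in> carrier P \<Longrightarrow> g (h x) = t x"
    using corner_map_factor[OF mP mM h t_closed t_add t_smult] by blast
  have "p (g y) = f y" if y: "y \<in> carrier Q" for y
  proof -
    obtain x where x: "x \<in> carrier P" "y = h x" using y by (rule corner_map_surj[OF h])
    obtain m where m: "m \<in> carrier M" "g' x = u m" using x(1) by (rule ex)
    have "v (p m) = v (f (h x))" using p'(2)[OF m(1)] g'(2)[OF x(1)] m(2) by simp
    then have "\<alpha> \<one>\<^bsub>A\<^esub> \<odot>\<^bsub>N\<^esub> p m = \<alpha> \<one>\<^bsub>A\<^esub> \<odot>\<^bsub>N\<^esub> f (h x)"
      using m x by (intro corner_map_eqD[OF v]) (auto simp: mod_hom_closed[OF p] mod_hom_closed[OF f]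
        corner_map_closed[OF h])
    also have "\<dots> = f (h (\<one>\<^bsub>A\<^esub> \<odot>\<^bsub>P\<^esub> x))"
      using x by (subst corner_map_alpha[OF mP mQ h]) (auto simp: mod_hom_smult[OF f] corner_map_closed[OF h])
    finally have "\<alpha> \<one>\<^bsub>A\<^esub> \<odot>\<^bsub>N\<^esub> p m = f y" using x by simp
    then show ?thesis using x m t[OF m] by (simp add: g(2) mod_hom_smult[OF p])
  qed
  with g(1) show "\<exists>g\<in>mod_hom B Q M. \<forall>y\<in>carrier Q. p (g y) = f y" by blast
qed (fact Q)

text \<open>
  The functor commutes with isomorphisms and direct sums, and is defined on all modules: a
  decomposition \<open>Z \<cong> X \<oplus> X'\<close> yields one of any corner of \<open>Z\<close>, for arbitrary choices of the corners of
  \<open>X\<close> and \<open>X'\<close>.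
\<close>

lemma add_closure_corner:
  assumes base: "\<And>X Y. X \<in> fg_modules A \<Longrightarrow> X \<in> U \<Longrightarrow> Y \<in> fg_modules B \<Longrightarrow> is_corner B \<beta> X Y \<Longrightarrow>
      Y \<in> add_closure B V"
    and "X \<in> add_closure A U" "Y \<in> fg_modules B" "is_corner B \<beta> X Y"
  shows "Y \<in> add_closure B V"
  using assms(2-4)
proof (induction arbitrary: Y)
  case (base X)
  then show ?case by (intro assms(1))
next
  case (iso X X')
  have "is_corner B \<beta> X Y"
    by (rule corner_iso_comp[OF fg_modulesD(1)[OF add_closure_fg[OF iso.hyps(1)]] iso.hyps(3) iso.prems(2)])
  then show ?case using iso.IH iso.prems(1) by blast
next
  case (zero X)
  then obtain h where h: "corner_map B \<beta> X Y h" by (auto simp: is_corner_def)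
  have "carrier Y = {\<zero>\<^bsub>Y\<^esub>}"
    using corner_map_image[OF h] corner_map_zero[OF _ _ h] zero by (simp add: fg_modulesD)
  then show ?case using zero by (intro add_closure.zero)
next
  case (dsum X X' Z)
  note fg = add_closure_fg[OF dsum.hyps(1)] add_closure_fg[OF dsum.hyps(2)]
  obtain W W' where W: "W \<in> fg_modules B" "is_corner B \<beta> X W"
    "W' \<in> fg_modules B" "is_corner B \<beta> X' W'"
    using corner_exists[OF fg_modulesD[OF fg(1)]] corner_exists[OF fg_modulesD[OF fg(2)]] by blast
  have "is_corner B \<beta> Z (mod_dsum W W')"
    using W fg by (intro corner_iso_comp[OF fg_modulesD(1)[OF dsum.hyps(3)] dsum.hyps(4)]
      corner_mod_dsum fg_modulesD)
  then have "mod_iso B Y (mod_dsum W W')"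
    using W dsum.hyps(3) dsum.prems by (intro corner_unique[of Z] module_mod_dsum fg_modulesD(1))
  moreover have "W \<in> add_closure B V" "W' \<in> add_closure B V"
    using W by (auto intro: dsum.IH)
  ultimately show ?case using dsum.prems(1) by (blast intro: add_closure.dsum)
next
  case (summand Z X X')
  have fg: "Z \<in> fg_modules A" using summand.hyps(1) by (rule add_closure_fg)
  obtain W W' where W: "W \<in> fg_modules B" "is_corner B \<beta> Z W"
    "W' \<in> fg_modules B" "is_corner B \<beta> X' W'"
    using corner_exists[OF fg_modulesD[OF fg]] corner_exists[OF fg_modulesD[OF summand.hyps(3)]] by blast
  have "is_corner B \<beta> Z (mod_dsum Y W')"
    using W fg summand.hyps(2,3) summand.prems
    by (intro corner_iso_comp[OF fg_modulesD(1)[OF fg] summand.hyps(4)] corner_mod_dsum fg_modulesD(1))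
  then have "mod_iso B W (mod_dsum Y W')"
    using W fg summand.prems by (intro corner_unique[of Z] module_mod_dsum fg_modulesD(1))
  moreover have "W \<in> add_closure B V" using W by (intro summand.IH)
  ultimately show ?case using W(3) summand.prems(1) by (blast intro: add_closure.summand)
qed

lemma corner_short_exact:
  assumes fg: "U \<in> fg_modules A" "X \<in> fg_modules A" "V \<in> fg_modules A"
      "U' \<in> fg_modules B" "Y \<in> fg_modules B" "V' \<in> fg_modules B"
    and c: "is_corner B \<beta> U U'" "is_corner B \<beta> X Y" "is_corner B \<beta> V V'"
    and ses: "short_exact A U f X g V"
  shows "\<exists>f' g'. short_exact B U' f' Y g' V'"
proof -
  obtain hU hX hV where h: "corner_map B \<beta> U U' hU" "corner_map B \<beta> X Y hX" "corner_map B \<beta> V V' hV"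
    using c by (auto simp: is_corner_def)
  note m = fg_modulesD(1)[OF fg(1)] fg_modulesD(1)[OF fg(2)] fg_modulesD(1)[OF fg(3)]
    fg_modulesD(1)[OF fg(4)] fg_modulesD(1)[OF fg(5)] fg_modulesD(1)[OF fg(6)]
  interpret U: Module.module A U by (rule m)
  have f: "f \<in> mod_hom A U X" "inj_on f (carrier U)" and g: "g \<in> mod_hom A X V" "g ` carrier X = carrier V"
    and ex: "f ` carrier U = a_kernel X V g"
    using ses by (auto simp: short_exact_def)
  obtain f' where f': "f' \<in> mod_hom B U' Y" "\<And>x. x \<in> carrier U \<Longrightarrow> f' (hU x) = hX (f x)"
    using corner_map_descend[OF m(1) m(5) f(1) h(1,2)] by blast
  obtain g' where g': "g' \<in> mod_hom B Y V'" "\<And>x. x \<in> carrier X \<Longrightarrow> g' (hX x) = hV (g x)"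
    using corner_map_descend[OF m(2) m(6) g(1) h(2,3)] by blast
  have "inj_on f' (carrier U')"
  proof (rule inj_onI)
    fix y y' assume y: "y \<in> carrier U'" "y' \<in> carrier U'" "f' y = f' y'"
    obtain x where x: "x \<in> carrier U" "y = hU x" using y(1) by (rule corner_map_surj[OF h(1)])
    obtain x' where x': "x' \<in> carrier U" "y' = hU x'" using y(2) by (rule corner_map_surj[OF h(1)])
    have "hX (f x) = hX (f x')" using y(3) x x' by (simp add: f')
    then have "e \<odot>\<^bsub>X\<^esub> f x = e \<odot>\<^bsub>X\<^esub> f x'"
      using x x' by (intro corner_map_eqD[OF h(2)] mod_hom_closed[OF f(1)])
    then have "f (e \<odot>\<^bsub>U\<^esub> x) = f (e \<odot>\<^bsub>U\<^esub> x')" using x x' by (simp add: mod_hom_smult[OF f(1)])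
    then have "e \<odot>\<^bsub>U\<^esub> x = e \<odot>\<^bsub>U\<^esub> x'" using x x' by (auto dest: inj_onD[OF f(2)])
    then show "y = y'" unfolding x(2) x'(2) by (intro corner_map_eqI[OF m(4) h(1) x(1) x'(1)])
  qed
  moreover have "f' ` carrier U' = a_kernel Y V' g'"
    by (rule corner_exact[OF m(2) m(3) m(5) m(6) g(1) ex h f'(2) g'(2)])
  moreover have "g' ` carrier Y = carrier V'"
  proof -
    have "g' ` carrier Y = hV ` g ` carrier X"
      using g'(2) by (simp add: image_image flip: corner_map_image[OF h(2)])
    then show ?thesis using g(2) corner_map_image[OF h(3)] by simp
  qed
  ultimately show ?thesis using f'(1) g'(1) unfolding short_exact_def by blast
qed

lemma ext_layer_corner:
  assumes N: "N \<in> fg_modules A" "N' \<in> fg_modules B" "is_corner B \<beta> N N'"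
    and "X \<in> ext_layer A {N} (Suc k)" "Y \<in> fg_modules B" "is_corner B \<beta> X Y"
  shows "Y \<in> ext_layer B {N'} (Suc k)"
  using assms(4-6)
proof (induction k arbitrary: X Y)
  case base: 0
  have "Y \<in> add_closure B {N'}"
  proof (rule add_closure_corner[where U = "{N}" and X = X])
    fix X Y assume "X \<in> {N}" and Y: "Y \<in> fg_modules B" and "is_corner B \<beta> X Y"
    then have "mod_iso B N' Y" using N by (intro corner_unique[of N]) (auto intro: fg_modulesD)
    then show "Y \<in> add_closure B {N'}"
      using N(2) Y add_closure.iso[OF add_closure.base] by blast
  qed (use base in auto)
  then show ?case by simp
next
  case (Suc k)
  let ?E = "ext_prod B (ext_layer B {N'} (Suc k)) (add_closure B {N'})"
  have "Y \<in> add_closure B ?E"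
  proof (rule add_closure_corner[where U = "ext_prod A (ext_layer A {N} (Suc k)) (add_closure A {N})"])
    fix X Y assume X: "X \<in> fg_modules A" "X \<in> ext_prod A (ext_layer A {N} (Suc k)) (add_closure A {N})"
      and Y: "Y \<in> fg_modules B" "is_corner B \<beta> X Y"
    obtain U V f g where U: "U \<in> ext_layer A {N} (Suc k)" and V: "V \<in> add_closure A {N}"
      and ses: "short_exact A U f X g V"
      using X(2) by (auto simp: ext_prod_def)
    note fg = ext_layer_fg[OF U] add_closure_fg[OF V]
    obtain U' V' where U': "U' \<in> fg_modules B" "is_corner B \<beta> U U'"
      and V': "V' \<in> fg_modules B" "is_corner B \<beta> V V'"
      using corner_exists[OF fg_modulesD[OF fg(1)]] corner_exists[OF fg_modulesD[OF fg(2)]] by blast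
    have "V' \<in> add_closure B {N'}"
    proof (rule add_closure_corner[OF _ V V'])
      fix X Y assume "X \<in> {N}" and Y: "Y \<in> fg_modules B" and "is_corner B \<beta> X Y"
      then have "mod_iso B N' Y" using N by (intro corner_unique[of N]) (auto intro: fg_modulesD)
      then show "Y \<in> add_closure B {N'}"
        using N(2) Y add_closure.iso[OF add_closure.base] by blast
    qed
    moreover have "U' \<in> ext_layer B {N'} (Suc k)" using Suc.IH[OF U U'] .
    moreover have "\<exists>f g. short_exact B U' f Y g V'"
      by (rule corner_short_exact[OF fg(1) X(1) fg(2) U'(1) Y(1) V'(1) U'(2) Y(2) V'(2) ses])
    ultimately have "Y \<in> ?E" using Y(1) unfolding ext_prod_def by blast
    then show "Y \<in> add_closure B ?E" using Y(1) by (intro add_closure.base)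
  qed (use Suc.prems in auto)
  then show ?case by simp
qed

text \<open>
  The functor is exact and preserves projectives, so it carries a projective resolution of \<open>M\<close>, term
  by term, to one of the corner of \<open>M\<close>; the image of \<open>P\<^sub>j \<rightarrow> P\<^sub>j\<^sub>-\<^sub>1\<close> goes to the image of the new differential.
\<close>

lemma Omega_corner:
  assumes K: "K \<in> Omega A j" and K': "K' \<in> fg_modules B" "is_corner B \<beta> K K'"
  shows "K' \<in> Omega B j"
proof (cases j)
  case 0
  then show ?thesis using K'(1) mod_iso_refl[of B K'] by (auto simp: Omega_def is_syzygy_def)
next
  case (Suc k)
  obtain M P d \<epsilon> where M: "M \<in> fg_modules A" and res: "proj_resolution A P d \<epsilon> M"
    and iso: "mod_iso A K ((P k)\<lparr>carrier := d k ` carrier (P (Suc k))\<rparr>)" and fgK: "K \<in> fg_modules A"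
    using K by (auto simp: Omega_def is_syzygy_def Suc)
  have P: "projective A (P i)" and d: "d i \<in> mod_hom A (P (Suc i)) (P i)" for i
    using res by (auto simp: proj_resolution_def)
  have \<epsilon>: "\<epsilon> \<in> mod_hom A (P 0) M" "\<epsilon> ` carrier (P 0) = carrier M" "d 0 ` carrier (P 1) = a_kernel (P 0) M \<epsilon>"
    and ex: "d (Suc i) ` carrier (P (Suc (Suc i))) = a_kernel (P (Suc i)) (P i) (d i)" for i
    using res by (auto simp: proj_resolution_def)
  have fgP: "P i \<in> fg_modules A" for i using P by (simp add: projective_def)
  note mP = fg_modulesD(1)[OF fgP] and mM = fg_modulesD(1)[OF M]
  have "\<exists>Q h. Q \<in> fg_modules B \<and> corner_map B \<beta> (P i) Q h" for i
    using corner_exists[OF fg_modulesD[OF fgP]] unfolding is_corner_def by blast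
  then obtain Q h where fgQ: "\<And>i. Q i \<in> fg_modules B" and h: "\<And>i. corner_map B \<beta> (P i) (Q i) (h i)"
    by metis
  obtain M' h\<^sub>M where M': "M' \<in> fg_modules B" and hM: "corner_map B \<beta> M M' h\<^sub>M"
    using corner_exists[OF fg_modulesD[OF M]] by (auto simp: is_corner_def)
  note mQ = fg_modulesD(1)[OF fgQ] and mM' = fg_modulesD(1)[OF M']
  have "\<exists>g. g \<in> mod_hom B (Q (Suc i)) (Q i) \<and> (\<forall>x\<in>carrier (P (Suc i)). g (h (Suc i) x) = h i (d i x))" for i
    using corner_map_descend[OF mP mQ d h h] by metis
  then obtain d' where d': "\<And>i. d' i \<in> mod_hom B (Q (Suc i)) (Q i)"
    and d'h: "\<And>i x. x \<in> carrier (P (Suc i)) \<Longrightarrow> d' i (h (Suc i) x) = h i (d i x)" by metis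
  obtain \<epsilon>' where \<epsilon>': "\<epsilon>' \<in> mod_hom B (Q 0) M'" "\<And>x. x \<in> carrier (P 0) \<Longrightarrow> \<epsilon>' (h 0 x) = h\<^sub>M (\<epsilon> x)"
    using corner_map_descend[OF mP mM' \<epsilon>(1) h hM] by blast
  have "proj_resolution B Q d' \<epsilon>' M'"
    unfolding proj_resolution_def
  proof (intro conjI allI)
    fix i
    show "projective B (Q i)" by (rule corner_projective[OF P fgQ h])
    show "d' i \<in> mod_hom B (Q (Suc i)) (Q i)" by (rule d')
    show "d' (Suc i) ` carrier (Q (Suc (Suc i))) = a_kernel (Q (Suc i)) (Q i) (d' i)"
      by (rule corner_exact[OF mP mP mQ mQ d ex h h h d'h d'h])
  next
    show "\<epsilon>' \<in> mod_hom B (Q 0) M'" by (rule \<epsilon>'(1))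
    have "\<epsilon>' ` carrier (Q 0) = h\<^sub>M ` \<epsilon> ` carrier (P 0)"
      using \<epsilon>'(2) by (simp add: image_image flip: corner_map_image[OF h])
    then show "\<epsilon>' ` carrier (Q 0) = carrier M'" using \<epsilon>(2) corner_map_image[OF hM] by simp
    show "d' 0 ` carrier (Q 1) = a_kernel (Q 0) M' \<epsilon>'"
      using corner_exact[OF mP mM mQ mM' \<epsilon>(1) \<epsilon>(3) _ h hM _ \<epsilon>'(2), of "Q 1" "h 1" "d' 0"] h[of 1] d'h[of _ 0]
      by simp
  qed
  moreover have "mod_iso B K' ((Q k)\<lparr>carrier := d' k ` carrier (Q (Suc k))\<rparr>)"
  proof -
    let ?I = "(P k)\<lparr>carrier := d k ` carrier (P (Suc k))\<rparr>"
    let ?J = "(Q k)\<lparr>carrier := d' k ` carrier (Q (Suc k))\<rparr>"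
    have sub: "x \<in> carrier (P k)" if "x \<in> d k ` carrier (P (Suc k))" for x
      using that mod_hom_closed[OF d] by auto
    have im: "h k ` d k ` carrier (P (Suc k)) = d' k ` carrier (Q (Suc k))"
      using d'h by (simp add: image_image flip: corner_map_image[OF h])
    have "corner_map B \<beta> ?I ?J (h k)"
      unfolding corner_map_def
    proof (intro conjI ballI impI)
      fix x x' assume "x \<in> carrier ?I" "x' \<in> carrier ?I" "h k x = h k x'"
      then show "e \<odot>\<^bsub>?I\<^esub> x = e \<odot>\<^bsub>?I\<^esub> x'"
        using sub corner_map_eqD[OF h, of x k x'] by simp
    qed (use im sub in \<open>simp_all add: corner_map_add[OF h] corner_map_smult[OF h]\<close>)
    then have "is_corner B \<beta> K ?J"
      using corner_iso_comp[OF fg_modulesD(1)[OF fgK] iso] is_corner_def by blast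
    then show ?thesis
      using K' fg_modulesD(1)[OF fgK] mod_hom_image_module[OF mQ mQ d']
      by (intro corner_unique[of K]) (auto intro: fg_modulesD)
  qed
  ultimately have "is_syzygy B j M' K'" by (auto simp: is_syzygy_def Suc)
  then show ?thesis using K'(1) M' by (auto simp: Omega_def)
qed

text \<open>
  Going to \<open>B\<close> and back cuts out the part \<open>eX\<close>.
\<close>

lemma corner_comp:
  assumes X: "Module.module A X" and Y: "Module.module B Y" and Z: "Module.module A Z"
    and "is_corner B \<beta> X Y" "is_corner A \<alpha> Y Z"
  shows "is_corner A ((\<otimes>\<^bsub>A\<^esub>) e) X Z"
proof -
  interpret F: common_corner B A \<beta> \<alpha> by (rule flip)
  obtain h k where h: "corner_map B \<beta> X Y h" and k: "corner_map A \<alpha> Y Z k"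
    using assms by (auto simp: is_corner_def)
  have "corner_map A ((\<otimes>\<^bsub>A\<^esub>) e) X Z (\<lambda>x. k (h x))"
    unfolding corner_map_def
  proof (intro conjI ballI impI)
    fix x x' assume x: "x \<in> carrier X" "x' \<in> carrier X"
    show "k (h (x \<oplus>\<^bsub>X\<^esub> x')) = k (h x) \<oplus>\<^bsub>Z\<^esub> k (h x')"
      using x by (simp add: corner_map_add[OF h] corner_map_add[OF k] corner_map_closed[OF h])
    assume "k (h x) = k (h x')"
    then have "\<alpha> \<one>\<^bsub>A\<^esub> \<odot>\<^bsub>Y\<^esub> h x = \<alpha> \<one>\<^bsub>A\<^esub> \<odot>\<^bsub>Y\<^esub> h x'"
      using x by (intro corner_map_eqD[OF k] corner_map_closed[OF h])
    then have "h x = h x'"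
      using x corner_map_alpha[OF X Y h A.one_closed] Module.module.smult_one[OF X] by metis
    then show "(e \<otimes>\<^bsub>A\<^esub> \<one>\<^bsub>A\<^esub>) \<odot>\<^bsub>X\<^esub> x = (e \<otimes>\<^bsub>A\<^esub> \<one>\<^bsub>A\<^esub>) \<odot>\<^bsub>X\<^esub> x'"
      using corner_map_eqD[OF h x] by simp
  next
    fix a x assume a: "a \<in> carrier A" and x: "x \<in> carrier X"
    have "h ((e \<otimes>\<^bsub>A\<^esub> a) \<odot>\<^bsub>X\<^esub> x) = \<alpha> a \<odot>\<^bsub>Y\<^esub> h x"
      using a x by (simp add: corner_map_smult[OF h] flip: beta_alpha)
    then show "k (h ((e \<otimes>\<^bsub>A\<^esub> a) \<odot>\<^bsub>X\<^esub> x)) = a \<odot>\<^bsub>Z\<^esub> k (h x)"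
      using a x by (simp add: corner_map_smult[OF k] corner_map_closed[OF h])
  next
    show "(\<lambda>x. k (h x)) ` carrier X = carrier Z"
      using image_image[of k h "carrier X"] corner_map_image[OF h] corner_map_image[OF k] by simp
  qed
  then show ?thesis by (auto simp: is_corner_def)
qed

text \<open>
  If \<open>e' = \<one>\<close>, then \<open>e'Y = Y\<close>, so going to \<open>A\<close> and back loses nothing.
\<close>

lemma corner_reverse:
  assumes one: "\<alpha> \<one>\<^bsub>A\<^esub> = \<one>\<^bsub>B\<^esub>" and Y: "Module.module B Y"
    and "is_corner A \<alpha> Y X"
  shows "is_corner B \<beta> X Y"
proof -
  interpret Y: Module.module B Y by (rule Y)
  obtain k where k: "corner_map A \<alpha> Y X k" using assms by (auto simp: is_corner_def)
  have inj: "inj_on k (carrier Y)"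
    using corner_map_eqD[OF k] one by (intro inj_onI) force
  define h where "h = the_inv_into (carrier Y) k"
  have hk: "h (k y) = y" if "y \<in> carrier Y" for y
    unfolding h_def using inj that by (rule the_inv_into_f_f)
  have "corner_map B \<beta> X Y h"
    unfolding corner_map_def
  proof (intro conjI ballI impI)
    show "h ` carrier X = carrier Y"
      using hk by (simp add: image_image flip: corner_map_image[OF k])
    fix x x' assume x: "x \<in> carrier X" "x' \<in> carrier X"
    obtain y where y: "y \<in> carrier Y" "x = k y" using x(1) by (rule corner_map_surj[OF k])
    obtain y' where y': "y' \<in> carrier Y" "x' = k y'" using x(2) by (rule corner_map_surj[OF k])
    show "h (x \<oplus>\<^bsub>X\<^esub> x') = h x \<oplus>\<^bsub>Y\<^esub> h x'"
      using y y' by (simp add: hk flip: corner_map_add[OF k])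
    assume "h x = h x'"
    then show "e \<odot>\<^bsub>X\<^esub> x = e \<odot>\<^bsub>X\<^esub> x'" using y y' by (simp add: hk)
  next
    fix b x assume b: "b \<in> carrier B" and x: "x \<in> carrier X"
    obtain y where y: "y \<in> carrier Y" "x = k y" using x(1) by (rule corner_map_surj[OF k])
    have "\<beta> b \<odot>\<^bsub>X\<^esub> k y = k (b \<odot>\<^bsub>Y\<^esub> y)"
      using y b one by (simp add: alpha_beta flip: corner_map_smult[OF k])
    then show "h (\<beta> b \<odot>\<^bsub>X\<^esub> x) = b \<odot>\<^bsub>Y\<^esub> h x" using y b by (simp add: hk)
  qed
  then show ?thesis by (auto simp: is_corner_def)
qed

text \<open>
  Every \<open>j\<close>-th syzygy \<open>K'\<close> over \<open>B\<close> is a corner of a module \<open>K\<close> over \<open>A\<close> which is itself a corner of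
  \<open>K'\<close>, hence a \<open>j\<close>-th syzygy over \<open>A\<close>; a bound for \<open>K\<close> over \<open>A\<close> is carried back to \<open>K'\<close>.
\<close>

lemma ext_dim_Omega_corner:
  assumes one: "\<alpha> \<one>\<^bsub>A\<^esub> = \<one>\<^bsub>B\<^esub>" and le: "ext_dim A (Omega A j) \<le> enat n"
  shows "ext_dim B (Omega B j) \<le> enat n"
proof -
  interpret F: common_corner B A \<beta> \<alpha> by (rule flip)
  obtain N where N: "N \<in> fg_modules A" "Omega A j \<subseteq> ext_layer A {N} (Suc n)"
    using le ext_dim_le_iff[OF A.is_cring] by blast
  obtain N' where N': "N' \<in> fg_modules B" "is_corner B \<beta> N N'"
    using corner_exists[OF fg_modulesD[OF N(1)]] by blast
  have "K' \<in> ext_layer B {N'} (Suc n)" if K': "K' \<in> Omega B j" for K'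
  proof -
    have fg: "K' \<in> fg_modules B" using K' by (simp add: Omega_def)
    obtain K where K: "K \<in> fg_modules A" "is_corner A \<alpha> K' K"
      using F.corner_exists[OF fg_modulesD[OF fg]] by blast
    have "K \<in> ext_layer A {N} (Suc n)" using F.Omega_corner[OF K' K] N(2) by blast
    then show ?thesis
      using corner_reverse[OF one fg_modulesD(1)[OF fg] K(2)]
      by (rule ext_layer_corner[OF N(1) N' _ fg])
  qed
  then show ?thesis using N'(1) ext_dim_le_iff[OF B.is_cring] by blast
qed

end

section \<open>Idempotents\<close>

lemma (in cring) common_corner_idempotent:
  assumes "e \<in> carrier R" "e \<otimes> e = e"
  shows "common_corner R R ((\<otimes>) e) ((\<otimes>) e)"
proof -
  have ee: "e \<otimes> (e \<otimes> a) = e \<otimes> a" if "a \<in> carrier R" for a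
    using that assms by (simp flip: m_assoc)
  show ?thesis
    by unfold_locales (use assms in \<open>auto simp: r_distr m_ac ee\<close>)
qed

text \<open>
  For orthogonal idempotents, \<open>(e + f)X = eX \<oplus> fX\<close>.
\<close>

lemma (in cring) idempotent_corner_sum:
  assumes e: "e \<in> carrier R" "e \<otimes> e = e" and f: "f \<in> carrier R" "f \<otimes> f = f" and ef: "e \<otimes> f = \<zero>"
    and X: "Module.module R X" and Y: "Module.module R Y" and Y': "Module.module R Y'"
    and "is_corner R ((\<otimes>) e) X Y" "is_corner R ((\<otimes>) f) X Y'"
  shows "is_corner R ((\<otimes>) (e \<oplus> f)) X (mod_dsum Y Y')"
proof -
  interpret X: Module.module R X by (rule X)
  interpret Y: Module.module R Y by (rule Y)
  interpret Y': Module.module R Y' by (rule Y')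
  interpret E: common_corner R R "(\<otimes>) e" "(\<otimes>) e" by (rule common_corner_idempotent[OF e])
  interpret F: common_corner R R "(\<otimes>) f" "(\<otimes>) f" by (rule common_corner_idempotent[OF f])
  obtain h h' where h: "corner_map R ((\<otimes>) e) X Y h" and h': "corner_map R ((\<otimes>) f) X Y' h'"
    using assms by (auto simp: is_corner_def)
  have he: "h (a \<odot>\<^bsub>X\<^esub> x) = a \<odot>\<^bsub>Y\<^esub> h x" if "a \<in> carrier R" "x \<in> carrier X" for a x
    using that e corner_map_smult[OF h that] E.corner_map_e[OF Y h, of "a \<odot>\<^bsub>X\<^esub> x"]
    by (simp add: X.smult_assoc1)
  have hf: "h' (a \<odot>\<^bsub>X\<^esub> x) = a \<odot>\<^bsub>Y'\<^esub> h' x" if "a \<in> carrier R" "x \<in> carrier X" for a x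
    using that f corner_map_smult[OF h' that] F.corner_map_e[OF Y' h', of "a \<odot>\<^bsub>X\<^esub> x"]
    by (simp add: X.smult_assoc1)
  have eh: "e \<odot>\<^bsub>Y\<^esub> h x = h x" if "x \<in> carrier X" for x
    using E.corner_map_e[OF Y h that] he[OF e(1) that] e(1) by simp
  have fh: "f \<odot>\<^bsub>Y'\<^esub> h' x = h' x" if "x \<in> carrier X" for x
    using F.corner_map_e[OF Y' h' that] hf[OF f(1) that] f(1) by simp
  have fe: "f \<otimes> e = \<zero>" using ef e f m_comm by metis
  have ef_h: "(e \<oplus> f) \<odot>\<^bsub>Y\<^esub> h x = h x" if x: "x \<in> carrier X" for x
  proof -
    have "f \<odot>\<^bsub>Y\<^esub> h x = f \<odot>\<^bsub>Y\<^esub> (e \<odot>\<^bsub>Y\<^esub> h x)" using eh[OF x] by simp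
    also have "\<dots> = \<zero>\<^bsub>Y\<^esub>"
      using x e f fe corner_map_closed[OF h x] by (simp flip: Y.smult_assoc1)
    finally show ?thesis
      using x e f eh[OF x] corner_map_closed[OF h x] by (simp add: Y.smult_l_distr)
  qed
  have ef_h': "(e \<oplus> f) \<odot>\<^bsub>Y'\<^esub> h' x = h' x" if x: "x \<in> carrier X" for x
  proof -
    have "e \<odot>\<^bsub>Y'\<^esub> h' x = e \<odot>\<^bsub>Y'\<^esub> (f \<odot>\<^bsub>Y'\<^esub> h' x)" using fh[OF x] by simp
    also have "\<dots> = \<zero>\<^bsub>Y'\<^esub>"
      using x e f ef corner_map_closed[OF h' x] by (simp flip: Y'.smult_assoc1)
    finally show ?thesis
      using x e f fh[OF x] corner_map_closed[OF h' x] by (simp add: Y'.smult_l_distr)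
  qed
  have "corner_map R ((\<otimes>) (e \<oplus> f)) X (mod_dsum Y Y') (\<lambda>x. (h x, h' x))"
    unfolding corner_map_def
  proof (intro conjI ballI impI)
    fix x x' assume x: "x \<in> carrier X" "x' \<in> carrier X"
    show "(h (x \<oplus>\<^bsub>X\<^esub> x'), h' (x \<oplus>\<^bsub>X\<^esub> x')) = (h x, h' x) \<oplus>\<^bsub>mod_dsum Y Y'\<^esub> (h x', h' x')"
      using x by (simp add: corner_map_add[OF h] corner_map_add[OF h'])
    assume "(h x, h' x) = (h x', h' x')"
    then have "e \<odot>\<^bsub>X\<^esub> x = e \<odot>\<^bsub>X\<^esub> x'" "f \<odot>\<^bsub>X\<^esub> x = f \<odot>\<^bsub>X\<^esub> x'"
      using corner_map_eqD[OF h x] corner_map_eqD[OF h' x] e f by simp_all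
    then show "((e \<oplus> f) \<otimes> \<one>) \<odot>\<^bsub>X\<^esub> x = ((e \<oplus> f) \<otimes> \<one>) \<odot>\<^bsub>X\<^esub> x'"
      using x e f by (simp add: X.smult_l_distr)
  next
    fix a x assume a: "a \<in> carrier R" and x: "x \<in> carrier X"
    show "(h (((e \<oplus> f) \<otimes> a) \<odot>\<^bsub>X\<^esub> x), h' (((e \<oplus> f) \<otimes> a) \<odot>\<^bsub>X\<^esub> x)) = a \<odot>\<^bsub>mod_dsum Y Y'\<^esub> (h x, h' x)"
      using a x e f corner_map_closed[OF h x] corner_map_closed[OF h' x] ef_h[of "x"] ef_h'[of "x"]
      by (simp add: he hf m_comm[of _ a] Y.smult_assoc1 Y'.smult_assoc1)
  next
    have "p \<in> (\<lambda>x. (h x, h' x)) ` carrier X" if p: "p \<in> carrier (mod_dsum Y Y')" for p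
    proof -
      obtain y y' where y: "p = (y, y')" "y \<in> carrier Y" "y' \<in> carrier Y'" using p by auto
      obtain x where x: "x \<in> carrier X" "y = h x" using y(2) by (rule corner_map_surj[OF h])
      obtain x' where x': "x' \<in> carrier X" "y' = h' x'" using y(3) by (rule corner_map_surj[OF h'])
      let ?z = "e \<odot>\<^bsub>X\<^esub> x \<oplus>\<^bsub>X\<^esub> f \<odot>\<^bsub>X\<^esub> x'"
      have z: "e \<odot>\<^bsub>X\<^esub> ?z = e \<odot>\<^bsub>X\<^esub> x" "f \<odot>\<^bsub>X\<^esub> ?z = f \<odot>\<^bsub>X\<^esub> x'"
        using x x' e f ef fe by (simp_all add: X.smult_r_distr flip: X.smult_assoc1)
      have zc: "?z \<in> carrier X" using x x' e f by simp
      have "h ?z = h x" "h' ?z = h' x'"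
        using E.corner_map_eqI[OF Y h zc x(1)] F.corner_map_eqI[OF Y' h' zc x'(1)] z e f by simp_all
      then show ?thesis using y(1) x x' zc by (intro image_eqI[of _ _ ?z]) simp_all
    qed
    then show "(\<lambda>x. (h x, h' x)) ` carrier X = carrier (mod_dsum Y Y')"
      by (auto simp: corner_map_closed[OF h] corner_map_closed[OF h'])
  qed
  then show ?thesis by (auto simp: is_corner_def)
qed

lemma ext_layer_dsum:
  assumes "X \<in> ext_layer R U (Suc k)" "Y \<in> ext_layer R U (Suc k)" "Z \<in> fg_modules R"
    and "mod_iso R Z (mod_dsum X Y)"
  shows "Z \<in> ext_layer R U (Suc k)"
  using assms ext_layer_Suc[of R U k] add_closure.dsum by metis

lemma ext_layer_summand:
  assumes "Z \<in> ext_layer R U (Suc k)" "X \<in> fg_modules R" "Y \<in> fg_modules R"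
    and "mod_iso R Z (mod_dsum X Y)"
  shows "X \<in> ext_layer R U (Suc k)"
  using assms ext_layer_Suc[of R U k] add_closure.summand by metis

lemma ext_layer_iso:
  assumes "X \<in> ext_layer R U (Suc k)" "Y \<in> fg_modules R" "mod_iso R X Y"
  shows "Y \<in> ext_layer R U (Suc k)"
  using assms ext_layer_Suc[of R U k] add_closure.iso by metis

lemma mod_iso_dsum_swap:
  assumes "mod_iso R Z (mod_dsum X Y)"
  shows "mod_iso R Z (mod_dsum Y X)"
proof -
  obtain h where h: "h \<in> mod_hom R Z (mod_dsum X Y)" "bij_betw h (carrier Z) (carrier (mod_dsum X Y))"
    using assms by (auto simp: mod_iso_def)
  have "prod.swap \<in> mod_hom R (mod_dsum X Y) (mod_dsum Y X)" by (auto simp: mod_hom_def)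
  from mod_hom_comp[OF h(1) this] have "(\<lambda>z. prod.swap (h z)) \<in> mod_hom R Z (mod_dsum Y X)" .
  moreover have "bij_betw prod.swap (carrier (mod_dsum X Y)) (carrier (mod_dsum Y X))"
    by (simp add: bij_betw_def product_swap)
  then have "bij_betw (\<lambda>z. prod.swap (h z)) (carrier Z) (carrier (mod_dsum Y X))"
    using bij_betw_trans[OF h(2)] by (simp add: comp_def)
  ultimately show ?thesis by (auto simp: mod_iso_def)
qed

text \<open>
  One module \<open>N\<close> has to serve for all members of \<open>U\<close>, so that the case \<open>e = \<one>\<close> is a bound for the
  extension dimension of \<open>U\<close>.
\<close>

definition corners_bounded :: "('r, 's) ring_scheme \<Rightarrow> 'r fg_module set \<Rightarrow> nat \<Rightarrow> 'r \<Rightarrow> bool" where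
  "corners_bounded R U n e \<longleftrightarrow> e \<in> carrier R \<and> e \<otimes>\<^bsub>R\<^esub> e = e \<and>
     (\<exists>N\<in>fg_modules R. \<forall>K\<in>U. \<forall>X\<in>fg_modules R.
        is_corner R ((\<otimes>\<^bsub>R\<^esub>) e) K X \<longrightarrow> X \<in> ext_layer R {N} (Suc n))"

lemma (in cring) corners_bounded_zero:
  assumes U: "U \<subseteq> fg_modules R"
  shows "corners_bounded R U n \<zero>"
proof -
  obtain N :: "'a fg_module" where N: "N \<in> fg_modules R"
    using fg_modules_zero[OF is_cring] by blast
  interpret common_corner R R "(\<otimes>) \<zero>" "(\<otimes>) \<zero>" by (rule common_corner_idempotent) simp_all
  have "X \<in> ext_layer R {N} (Suc n)" if K: "K \<in> U" and X: "X \<in> fg_modules R" and c: "is_corner R ((\<otimes>) \<zero>) K X" for K X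
  proof -
    have mK: "Module.module R K" and mX: "Module.module R X" using K X U fg_modulesD(1) by blast+
    interpret K: Module.module R K by (rule mK)
    obtain h where h: "corner_map R ((\<otimes>) \<zero>) K X h" using c by (auto simp: is_corner_def)
    have "h x = \<zero>\<^bsub>X\<^esub>" if "x \<in> carrier K" for x
      using corner_map_e[OF mX h that] that corner_map_zero[OF mK mX h] by simp
    then have "carrier X = {\<zero>\<^bsub>X\<^esub>}"
      using K.M.zero_closed by (auto simp flip: corner_map_image[OF h])
    then show ?thesis using X ext_layer_Suc[of R "{N}" n] add_closure.zero by metis
  qed
  with N show ?thesis by (auto simp: corners_bounded_def)
qed

text \<open>
  The idempotent in the conclusion is the join \<open>e + f - ef\<close>. It is the sum of the orthogonal idempotents
  \<open>e\<close> and \<open>g = f(1 - e)\<close>. Since \<open>f\<close> is the orthogonal sum of \<open>g\<close> and \<open>fe\<close>, the module \<open>gK\<close> is a direct summand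
  of \<open>fK\<close>, and therefore lies in the same layer.
\<close>

lemma (in cring) corners_bounded_join:
  assumes U: "U \<subseteq> fg_modules R" and be: "corners_bounded R U n e" and bf: "corners_bounded R U n f"
  shows "corners_bounded R U n (e \<oplus> f \<otimes> (\<one> \<ominus> e))"
proof -
  define c where "c = \<one> \<ominus> e"
  define g where "g = f \<otimes> c"
  have e: "e \<in> carrier R" "e \<otimes> e = e" and f: "f \<in> carrier R" "f \<otimes> f = f"
    using be bf by (auto simp: corners_bounded_def)
  have c: "c \<in> carrier R" "e \<otimes> c = \<zero>" "e \<oplus> c = \<one>"
    using e a_lcomm[of e \<one> "\<ominus> e"] by (simp_all add: c_def minus_eq r_distr r_minus r_neg)
  have "(e \<oplus> c) \<otimes> c = e \<otimes> c \<oplus> c \<otimes> c" by (rule l_distr[OF e(1) c(1) c(1)])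
  then have cc: "c \<otimes> c = c" using c by simp
  have g: "g \<in> carrier R" "g \<otimes> g = g"
  proof -
    have "g \<otimes> g = (f \<otimes> f) \<otimes> (c \<otimes> c)" unfolding g_def using f(1) c(1) by (simp add: m_ac)
    then show "g \<otimes> g = g" by (simp add: f cc g_def)
  qed (simp add: g_def f c)
  have eg: "e \<otimes> g = \<zero>"
  proof -
    have "e \<otimes> g = f \<otimes> (e \<otimes> c)" unfolding g_def using f(1) c(1) e(1) by (simp add: m_ac)
    then show ?thesis using f c by simp
  qed
  define d where "d = f \<otimes> e"
  have d: "d \<in> carrier R" "d \<otimes> d = d"
  proof -
    have "d \<otimes> d = (f \<otimes> f) \<otimes> (e \<otimes> e)" unfolding d_def using f(1) e(1) by (simp add: m_ac)
    then show "d \<otimes> d = d" by (simp add: f e d_def)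
  qed (simp add: d_def f e)
  have gd: "g \<otimes> d = \<zero>"
  proof -
    have "g \<otimes> d = (f \<otimes> f) \<otimes> (e \<otimes> c)" unfolding g_def d_def using f(1) c(1) e(1) by (simp add: m_ac)
    then show ?thesis using f c by simp
  qed
  have gd_f: "g \<oplus> d = f"
  proof -
    have "g \<oplus> d = f \<otimes> (e \<oplus> c)" unfolding g_def d_def using f(1) c(1) e(1) by (simp add: r_distr a_ac)
    then show ?thesis using f c by simp
  qed
  define j where "j = e \<oplus> g"
  have j: "j \<in> carrier R" "j \<otimes> j = j"
    using e g eg m_comm[of g e] by (simp_all add: j_def l_distr r_distr)
  obtain N\<^sub>e where Ne: "N\<^sub>e \<in> fg_modules R"
    and layer_e: "\<And>K X. K \<in> U \<Longrightarrow> X \<in> fg_modules R \<Longrightarrow> is_corner R ((\<otimes>) e) K X \<Longrightarrow> X \<in> ext_layer R {N\<^sub>e} (Suc n)"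
    using be unfolding corners_bounded_def by blast
  obtain N\<^sub>f where Nf: "N\<^sub>f \<in> fg_modules R"
    and layer_f: "\<And>K X. K \<in> U \<Longrightarrow> X \<in> fg_modules R \<Longrightarrow> is_corner R ((\<otimes>) f) K X \<Longrightarrow> X \<in> ext_layer R {N\<^sub>f} (Suc n)"
    using bf unfolding corners_bounded_def by blast
  obtain N where N: "N \<in> fg_modules R" "mod_iso R N (mod_dsum N\<^sub>e N\<^sub>f)"
    using fg_modules_dsum[OF Ne Nf] by blast
  have "N \<in> add_closure R {N}" using N(1) by (auto intro: add_closure.base)
  then have "N\<^sub>e \<in> add_closure R {N}" "N\<^sub>f \<in> add_closure R {N}"
    using add_closure.summand[OF _ Ne Nf N(2)] add_closure.summand[OF _ Nf Ne mod_iso_dsum_swap[OF N(2)]] by blast+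
  then have mono: "ext_layer R {N\<^sub>e} (Suc n) \<subseteq> ext_layer R {N} (Suc n)" "ext_layer R {N\<^sub>f} (Suc n) \<subseteq> ext_layer R {N} (Suc n)"
    by (auto intro!: ext_layer_mono)
  interpret E: common_corner R R "(\<otimes>) e" "(\<otimes>) e" by (rule common_corner_idempotent[OF e])
  interpret F: common_corner R R "(\<otimes>) f" "(\<otimes>) f" by (rule common_corner_idempotent[OF f])
  interpret G: common_corner R R "(\<otimes>) g" "(\<otimes>) g" by (rule common_corner_idempotent[OF g])
  interpret D: common_corner R R "(\<otimes>) d" "(\<otimes>) d" by (rule common_corner_idempotent[OF d])
  interpret J: common_corner R R "(\<otimes>) j" "(\<otimes>) j" by (rule common_corner_idempotent[OF j])
  have "X \<in> ext_layer R {N} (Suc n)"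
    if K: "K \<in> U" and X: "X \<in> fg_modules R" and cX: "is_corner R ((\<otimes>) j) K X" for K X
  proof -
    have K': "K \<in> fg_modules R" using K U by blast
    note fgK = fg_modulesD[OF K']
    obtain X\<^sub>e where Xe: "X\<^sub>e \<in> fg_modules R" "is_corner R ((\<otimes>) e) K X\<^sub>e" using E.corner_exists[OF fgK] by blast
    obtain X\<^sub>f where Xf: "X\<^sub>f \<in> fg_modules R" "is_corner R ((\<otimes>) f) K X\<^sub>f" using F.corner_exists[OF fgK] by blast
    obtain X\<^sub>g where Xg: "X\<^sub>g \<in> fg_modules R" "is_corner R ((\<otimes>) g) K X\<^sub>g" using G.corner_exists[OF fgK] by blast
    obtain X\<^sub>d where Xd: "X\<^sub>d \<in> fg_modules R" "is_corner R ((\<otimes>) d) K X\<^sub>d" using D.corner_exists[OF fgK] by blast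
    note m = fg_modulesD(1)[OF X] fg_modulesD(1)[OF Xe(1)] fg_modulesD(1)[OF Xf(1)]
      fg_modulesD(1)[OF Xg(1)] fg_modulesD(1)[OF Xd(1)]
    have "is_corner R ((\<otimes>) f) K (mod_dsum X\<^sub>g X\<^sub>d)"
      using idempotent_corner_sum[OF g d gd fgK(1) m(4,5) Xg(2) Xd(2)] unfolding gd_f .
    then have "mod_iso R X\<^sub>f (mod_dsum X\<^sub>g X\<^sub>d)"
      by (rule F.corner_unique[OF fgK(1) m(3) module_mod_dsum[OF m(4,5)] Xf(2)])
    moreover have "X\<^sub>f \<in> ext_layer R {N} (Suc n)" using layer_f[OF K Xf] mono by blast
    ultimately have Xg': "X\<^sub>g \<in> ext_layer R {N} (Suc n)" using Xg(1) Xd(1) ext_layer_summand by blast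
    have Xe': "X\<^sub>e \<in> ext_layer R {N} (Suc n)" using layer_e[OF K Xe] mono by blast
    have "is_corner R ((\<otimes>) j) K (mod_dsum X\<^sub>e X\<^sub>g)"
      using idempotent_corner_sum[OF e g eg fgK(1) m(2,4) Xe(2) Xg(2)] unfolding j_def .
    then have "mod_iso R X (mod_dsum X\<^sub>e X\<^sub>g)"
      by (rule J.corner_unique[OF fgK(1) m(1) module_mod_dsum[OF m(2,4)] cX])
    with Xe' Xg' X show ?thesis by (rule ext_layer_dsum)
  qed
  then have "corners_bounded R U n j" using N(1) j by (auto simp: corners_bounded_def)
  then show ?thesis by (simp add: j_def g_def c_def)
qed

lemma (in cring) exists_maximalideal:
  assumes I: "ideal I R" "\<one> \<notin> I"
  shows "\<exists>M. maximalideal M R \<and> I \<subseteq> M"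
proof -
  let ?A = "{J. ideal J R \<and> I \<subseteq> J \<and> \<one> \<notin> J}"
  have "\<exists>M\<in>?A. \<forall>X\<in>?A. M \<subseteq> X \<longrightarrow> X = M"
  proof (rule subset_Zorn_nonempty)
    show "?A \<noteq> {}" using I by blast
    fix C assume C: "C \<noteq> {}" "subset.chain ?A C"
    then have sub: "C \<subseteq> ?A" by (simp add: subset.chain_def)
    have "subset.chain {J. ideal J R} C" using C(2) by (auto simp: subset.chain_def)
    from chain_Union_is_ideal[OF this] C(1) have "ideal (\<Union>C) R" by simp
    moreover obtain J where "J \<in> C" using C(1) by blast
    then have "I \<subseteq> \<Union>C" using sub by blast
    moreover have "\<one> \<notin> \<Union>C" using sub by blast
    ultimately show "\<Union>C \<in> ?A" by simp
  qed
  then obtain M where "M \<in> ?A" and "\<forall>X\<in>?A. M \<subseteq> X \<longrightarrow> X = M" by (rule bexE)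
  then have M: "ideal M R" "I \<subseteq> M" "\<one> \<notin> M"
    and max: "\<And>J. ideal J R \<Longrightarrow> I \<subseteq> J \<Longrightarrow> \<one> \<notin> J \<Longrightarrow> M \<subseteq> J \<Longrightarrow> J = M" by simp_all
  have "maximalideal M R"
  proof (rule maximalidealI[OF M(1)])
    show "carrier R \<noteq> M" using M(3) one_closed by metis
    fix J assume J: "ideal J R" "M \<subseteq> J" "J \<subseteq> carrier R"
    show "J = M \<or> J = carrier R"
    proof (cases "\<one> \<in> J")
      case True
      then show ?thesis using ideal.one_imp_carrier[OF J(1)] by simp
    next
      case False
      have "I \<subseteq> J" using M(2) J(2) by (rule subset_trans)
      then show ?thesis using max[OF J(1) _ False J(2)] by simp
    qed
  qed
  then show ?thesis using M(2) by blast
qed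

text \<open>
  The elements fixed by some idempotent
  with bounded corners form an ideal, because joins of such idempotents are again such; by the
  local hypothesis no maximal ideal contains it, so it contains \<open>\<one>\<close>.
\<close>

lemma (in cring) corners_bounded_one:
  assumes U: "U \<subseteq> fg_modules R"
    and loc: "\<And>M. maximalideal M R \<Longrightarrow> \<exists>e. e \<notin> M \<and> corners_bounded R U n e"
  shows "corners_bounded R U n \<one>"
proof -
  define I where "I = {r \<in> carrier R. \<exists>e. corners_bounded R U n e \<and> e \<otimes> r = r}"
  have bc: "e \<in> carrier R" if "corners_bounded R U n e" for e using that by (simp add: corners_bounded_def)
  have "ideal I R"
  proof (rule idealI)
    show "subgroup I (add_monoid R)"
    proof (rule add.subgroupI)
      show "I \<subseteq> carrier R" by (auto simp: I_def)
      show "I \<noteq> {}" using corners_bounded_zero[OF U, of n] r_null[of \<zero>] unfolding I_def by blast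
      fix r assume "r \<in> I"
      then obtain e where r: "r \<in> carrier R" and e: "corners_bounded R U n e" "e \<otimes> r = r" by (auto simp: I_def)
      show "\<ominus> r \<in> I" using r e bc by (auto simp: I_def r_minus intro!: exI[of _ e])
      fix s assume "s \<in> I"
      then obtain f where s: "s \<in> carrier R" and f: "corners_bounded R U n f" "f \<otimes> s = s" by (auto simp: I_def)
      let ?j = "e \<oplus> f \<otimes> (\<one> \<ominus> e)"
      have ec: "e \<in> carrier R" and fc: "f \<in> carrier R" using bc e f by auto
      have "(\<one> \<ominus> e) \<otimes> r = \<zero>" using ec r e(2) by (simp add: minus_eq l_distr l_minus r_neg)
      then have jr: "?j \<otimes> r = r" using ec fc r e(2) by (simp add: l_distr m_assoc)
      have "f \<otimes> (\<one> \<ominus> e) \<otimes> s = (\<one> \<ominus> e) \<otimes> (f \<otimes> s)" using ec fc s by (simp add: m_ac)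
      also have "\<dots> = s \<ominus> e \<otimes> s" using ec s f(2) by (simp add: minus_eq l_distr l_minus)
      finally have js: "?j \<otimes> s = s" using ec fc s by (simp add: l_distr minus_eq a_ac r_neg2 r_neg1 r_neg)
      have "?j \<otimes> (r \<oplus> s) = r \<oplus> s" using jr js ec fc r s by (simp add: r_distr)
      then show "r \<oplus> s \<in> I" using corners_bounded_join[OF U e(1) f(1)] r s by (auto simp: I_def)
    qed
    fix a x assume a: "a \<in> I" and x: "x \<in> carrier R"
    then obtain e where e: "a \<in> carrier R" "corners_bounded R U n e" "e \<otimes> a = a" by (auto simp: I_def)
    have "e \<otimes> (a \<otimes> x) = a \<otimes> x" using e x bc by (simp flip: m_assoc)
    then show "a \<otimes> x \<in> I" using e x by (auto simp: I_def)
    then show "x \<otimes> a \<in> I" using e x by (simp add: m_comm)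
  qed (rule ring_axioms)
  have "\<one> \<in> I"
  proof (rule ccontr)
    assume "\<one> \<notin> I"
    then obtain M where M: "maximalideal M R" "I \<subseteq> M" using exists_maximalideal \<open>ideal I R\<close> by blast
    obtain e where e: "e \<notin> M" "corners_bounded R U n e" using loc[OF M(1)] by blast
    then have "e \<in> I" by (auto simp: I_def corners_bounded_def)
    then show False using M(2) e(1) by blast
  qed
  then show ?thesis using bc by (auto simp: I_def)
qed

section \<open>Localization of a commutative Artin ring at a prime\<close>

text \<open>
  By the descending chain condition, some principal ideal \<open>sR\<close> with \<open>s \<notin> \<pp>\<close> is minimal among those, so that
  \<open>sR = stR\<close> for all \<open>t \<notin> \<pp>\<close>. For \<open>t = s\<close> this gives \<open>s = xs\<^sup>2\<close>, and \<open>e = sx\<close> is an idempotent with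
  \<open>es = s\<close>, so that \<open>e \<notin> \<pp>\<close>; for general \<open>t\<close> it shows that \<open>t\<close> divides \<open>s\<close>, hence \<open>e\<close>.
\<close>

lemma (in artinian_cring) prime_idempotent:
  assumes P: "primeideal P R"
  shows "\<exists>e\<in>carrier R - P. e \<otimes> e = e \<and> (\<forall>s\<in>carrier R - P. \<exists>t\<in>carrier R. t \<otimes> s = e)"
proof -
  interpret P: primeideal P R by fact
  define S where "S = carrier R - P"
  interpret S: mult_subset R S unfolding S_def by (rule P.mult_subset_compl)
  have "\<exists>s\<in>S. \<forall>t\<in>S. s \<in> PIdl (s \<otimes> t)"
  proof (rule ccontr)
    assume "\<not> ?thesis"
    \<comment> \<open>Otherwise the products of successively chosen \<open>t\<close> generate a strictly descending chain.\<close>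
    then obtain t where t: "\<And>s. s \<in> S \<Longrightarrow> t s \<in> S \<and> s \<notin> PIdl (s \<otimes> t s)" by metis
    define s where "s = rec_nat \<one> (\<lambda>_ r. r \<otimes> t r)"
    have s: "s 0 = \<one>" "s (Suc k) = s k \<otimes> t (s k)" for k by (simp_all add: s_def)
    have sS: "s k \<in> S" for k
    proof (induction k)
      case (Suc k)
      then show ?case using t[OF Suc] S.m_closed by (simp only: s)
    qed (use S.one_closed s in simp)
    have tS: "t (s k) \<in> carrier R" for k using t[OF sS] S.mem_carr by blast
    have sR: "s k \<in> carrier R" for k using sS by simp
    have "PIdl (s (Suc k)) \<subseteq> PIdl (s k)" for k
    proof -
      have "s (Suc k) \<in> PIdl (s k)"
        unfolding s cgenideal_def using sR tS m_comm by blast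
      then show ?thesis using cgenideal_minimal[OF cgenideal_ideal[OF sR]] by blast
    qed
    then obtain m where "PIdl (s (Suc m)) = PIdl (s m)"
      using descending_chain[of "\<lambda>k. PIdl (s k)"] cgenideal_ideal[OF sR] by (metis le_Suc_eq order_refl)
    then have "s m \<in> PIdl (s m \<otimes> t (s m))" using cgenideal_self[OF sR] s by metis
    then show False using t[OF sS] by blast
  qed
  then obtain s where s: "s \<in> S" "s \<in> carrier R" and min: "\<And>t. t \<in> S \<Longrightarrow> s \<in> PIdl (s \<otimes> t)"
    using S.mem_carr by blast
  obtain x where x: "x \<in> carrier R" "s = x \<otimes> (s \<otimes> s)"
    using min[OF s(1)] unfolding cgenideal_def by blast
  let ?e = "s \<otimes> x"
  have "s \<otimes> ?e = x \<otimes> (s \<otimes> s)" using x(1) s(2) by (simp add: m_ac)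
  then have se: "s \<otimes> ?e = s" by (rule trans[OF _ x(2)[symmetric]])
  have "?e \<notin> P" using P.I_l_closed[of ?e s] s unfolding se S_def by blast
  moreover have "?e \<in> carrier R" using s(2) x(1) by (rule m_closed)
  ultimately have "?e \<in> S" unfolding S_def by blast
  moreover have "?e \<otimes> ?e = ?e"
  proof -
    have "?e \<otimes> ?e = (s \<otimes> ?e) \<otimes> x" using s(2) x(1) by (simp add: m_ac)
    then show ?thesis by (simp add: se)
  qed
  moreover have "\<exists>t'\<in>carrier R. t' \<otimes> t = ?e" if t: "t \<in> S" for t
  proof -
    obtain y where y: "y \<in> carrier R" "s = y \<otimes> (s \<otimes> t)"
      using min[OF t] unfolding cgenideal_def by blast
    have "t \<in> carrier R" using t by simp
    then have "(x \<otimes> y \<otimes> s) \<otimes> t = x \<otimes> (y \<otimes> (s \<otimes> t))" using x(1) y(1) s(2) by (simp add: m_ac)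
    also have "\<dots> = x \<otimes> s" unfolding y(2)[symmetric] ..
    also have "\<dots> = ?e" using x(1) s(2) by (rule m_comm)
    finally show ?thesis using x(1) y(1) s(2) by (intro bexI[of _ "x \<otimes> y \<otimes> s"]) simp_all
  qed
  ultimately have "?e \<in> S \<and> ?e \<otimes> ?e = ?e \<and> (\<forall>t\<in>S. \<exists>t'\<in>carrier R. t' \<otimes> t = ?e)" by simp
  then show ?thesis unfolding S_def by (intro bexI[of _ ?e] conjI) (elim conjE, assumption)+
qed

text \<open>
  The map \<open>R \<rightarrow> R\<^sub>\<pp>\<close> identifies \<open>R\<^sub>\<pp>\<close> with \<open>eR\<close>, for the idempotent \<open>e\<close> of \<open>prime_idempotent\<close>. It sends \<open>a\<close> and
  \<open>b\<close> to the same element iff \<open>ua = ub\<close> for some \<open>u \<notin> \<pp>\<close>, which is equivalent to \<open>ea = eb\<close> since \<open>e \<notin> \<pp>\<close> and \<open>u\<close> divides \<open>e\<close>. It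
  is surjective, because \<open>a/s = ta/1\<close> if \<open>ts = e\<close>.
\<close>

lemma (in artinian_cring) localization_common_corner:
  assumes P: "primeideal P R"
  shows "\<exists>\<alpha> \<beta>. common_corner R (localization_at R P) \<alpha> \<beta> \<and>
    \<alpha> \<one> = \<one>\<^bsub>localization_at R P\<^esub> \<and> \<beta> \<one>\<^bsub>localization_at R P\<^esub> \<notin> P"
proof -
  interpret P: primeideal P R by fact
  define S where "S = carrier R - P"
  interpret S: mult_subset R S unfolding S_def by (rule P.mult_subset_compl)
  obtain e where "e \<in> S" "e \<otimes> e = e \<and> (\<forall>s\<in>S. \<exists>t\<in>carrier R. t \<otimes> s = e)"
    using prime_idempotent[OF P, folded S_def] by (rule bexE)
  then have e: "e \<in> S" "e \<otimes> e = e" and div: "\<And>s. s \<in> S \<Longrightarrow> \<exists>t\<in>carrier R. t \<otimes> s = e"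
    by simp_all
  have eR: "e \<in> carrier R" using e(1) by simp
  have ee: "e \<otimes> (e \<otimes> a) = e \<otimes> a" if "a \<in> carrier R" for a
    using that eR e(2) by (simp flip: m_assoc)
  let ?L = "localization R S"
  define \<alpha> where "\<alpha> a = fraction R S a \<one>" for a
  have \<alpha>_eq: "\<alpha> a = \<alpha> b \<longleftrightarrow> e \<otimes> a = e \<otimes> b" if ab: "a \<in> carrier R" "b \<in> carrier R" for a b
  proof
    assume "\<alpha> a = \<alpha> b"
    then obtain u where u: "u \<in> S" "u \<otimes> a = u \<otimes> b" using ab by (auto simp: \<alpha>_def S.fraction_eq_iff)
    obtain t where t: "t \<in> carrier R" "t \<otimes> u = e" using div[OF u(1)] by blast
    have "t \<otimes> u \<otimes> a = t \<otimes> u \<otimes> b" using u t(1) ab S.mem_carr[OF u(1)] by (simp add: m_assoc)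
    then show "e \<otimes> a = e \<otimes> b" by (simp add: t(2))
  next
    assume "e \<otimes> a = e \<otimes> b"
    then show "\<alpha> a = \<alpha> b" using ab e(1) by (auto simp: \<alpha>_def S.fraction_eq_iff)
  qed
  have \<alpha>_surj: "\<exists>a\<in>carrier R. X = \<alpha> a" if X: "X \<in> carrier ?L" for X
  proof -
    obtain a s where a: "a \<in> carrier R" "s \<in> S" "X = fraction R S a s" using X by (rule S.fraction_cases)
    obtain t where t: "t \<in> carrier R" "t \<otimes> s = e" using div[OF a(2)] by blast
    have "s \<otimes> (t \<otimes> a) = (t \<otimes> s) \<otimes> a" using a(1) t(1) S.mem_carr[OF a(2)] by (simp add: m_ac)
    then have "s \<otimes> (t \<otimes> a) = e \<otimes> a" by (simp add: t(2))
    then have "X = \<alpha> (t \<otimes> a)"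
      unfolding a(3) \<alpha>_def using a(1,2) t(1) e(1) ee[OF a(1)]
      by (subst S.fraction_eq_iff) (auto intro!: bexI[of _ e])
    then show ?thesis using t(1) a(1) by blast
  qed
  define \<beta> where "\<beta> X = e \<otimes> (SOME a. a \<in> carrier R \<and> \<alpha> a = X)" for X
  have \<beta>: "\<beta> (\<alpha> a) = e \<otimes> a" if a: "a \<in> carrier R" for a
    unfolding \<beta>_def using a by (rule_tac someI2[of _ a]) (auto simp: \<alpha>_eq)
  have \<alpha>_add: "\<alpha> (a \<oplus> b) = \<alpha> a \<oplus>\<^bsub>?L\<^esub> \<alpha> b" and \<alpha>_mult: "\<alpha> (a \<otimes> b) = \<alpha> a \<otimes>\<^bsub>?L\<^esub> \<alpha> b"
    if "a \<in> carrier R" "b \<in> carrier R" for a b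
    using that by (simp_all add: \<alpha>_def S.fraction_add S.fraction_mult)
  have \<alpha>_one: "\<alpha> \<one> = \<one>\<^bsub>?L\<^esub>" by (simp add: \<alpha>_def S.localization_one)
  have \<beta>_one: "\<beta> \<one>\<^bsub>?L\<^esub> = e" using \<beta>[of \<one>] eR by (simp add: \<alpha>_one)
  interpret L: cring ?L by (rule S.cring_localization)
  have "common_corner R ?L \<alpha> \<beta>"
  proof
    show "\<alpha> a \<in> carrier ?L" if "a \<in> carrier R" for a using that by (simp add: \<alpha>_def)
    show "\<alpha> (a \<oplus> b) = \<alpha> a \<oplus>\<^bsub>?L\<^esub> \<alpha> b" "\<alpha> (a \<otimes> b) = \<alpha> a \<otimes>\<^bsub>?L\<^esub> \<alpha> b"
      if "a \<in> carrier R" "b \<in> carrier R" for a b using that \<alpha>_add \<alpha>_mult by auto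
    show "\<beta> (\<alpha> a) = \<beta> \<one>\<^bsub>?L\<^esub> \<otimes> a" if "a \<in> carrier R" for a using that by (simp add: \<beta> \<beta>_one)
    fix X assume "X \<in> carrier ?L"
    then obtain a where a: "a \<in> carrier R" "X = \<alpha> a" using \<alpha>_surj by blast
    show "\<beta> X \<in> carrier R" using a eR by (simp add: \<beta>)
    have "\<alpha> (e \<otimes> a) = \<alpha> a" using a(1) eR by (subst \<alpha>_eq) (auto simp: ee)
    then show "\<alpha> (\<beta> X) = \<alpha> \<one> \<otimes>\<^bsub>?L\<^esub> X" using \<open>X \<in> carrier ?L\<close> a by (simp add: \<beta> \<alpha>_one)
    fix Y assume "Y \<in> carrier ?L"
    then obtain b where b: "b \<in> carrier R" "Y = \<alpha> b" using \<alpha>_surj by blast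
    show "\<beta> (X \<oplus>\<^bsub>?L\<^esub> Y) = \<beta> X \<oplus> \<beta> Y"
      using a b eR \<beta>[of "a \<oplus> b"] by (simp add: \<beta> r_distr flip: \<alpha>_add)
    have "e \<otimes> (a \<otimes> b) = (e \<otimes> a) \<otimes> (e \<otimes> b)"
      using a(1) b(1) eR ee[of "a \<otimes> b"] by (simp add: m_ac)
    then show "\<beta> (X \<otimes>\<^bsub>?L\<^esub> Y) = \<beta> X \<otimes> \<beta> Y"
      using a b \<beta>[of "a \<otimes> b"] by (simp add: \<beta> flip: \<alpha>_mult)
  qed
  then show ?thesis using \<alpha>_one \<beta>_one e(1) unfolding localization_at_def S_def by blast
qed

section \<open>From the localizations to the ring\<close>

text \<open>
  At a maximal ideal \<open>\<mm>\<close> with idempotent \<open>e\<close>, a syzygy \<open>K\<close> localizes to a syzygy over \<open>R\<^sub>\<mm>\<close>. The bound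
  available there is carried by restriction of scalars to a bound for \<open>eK\<close> over \<open>R\<close>. These bounds
  are then glued.
\<close>

lemma (in artinian_cring) ext_dim_Omega_local_global:
  assumes "\<And>M. maximalideal M R \<Longrightarrow> ext_dim (localization_at R M) (Omega (localization_at R M) j) \<le> enat n"
  shows "ext_dim R (Omega R j) \<le> enat n"
proof -
  have U: "Omega R j \<subseteq> fg_modules R" by (auto simp: Omega_def)
  have "\<exists>e. e \<notin> M \<and> corners_bounded R (Omega R j) n e" if M: "maximalideal M R" for M
  proof -
    let ?L = "localization_at R M"
    obtain \<alpha> \<beta> where "common_corner R ?L \<alpha> \<beta>" and notin: "\<beta> \<one>\<^bsub>?L\<^esub> \<notin> M"
      using localization_common_corner[OF maximalideal_prime[OF M]] by blast
    interpret C: common_corner R ?L \<alpha> \<beta> by fact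
    interpret F: common_corner ?L R \<beta> \<alpha> by (rule C.flip)
    have idem: "C.e \<in> carrier R" "C.e \<otimes> C.e = C.e" using C.e_beta[of "\<one>\<^bsub>?L\<^esub>"] by simp_all
    interpret E: common_corner R R "(\<otimes>) C.e" "(\<otimes>) C.e" by (rule common_corner_idempotent[OF idem])
    obtain N' where N': "N' \<in> fg_modules ?L" "Omega ?L j \<subseteq> ext_layer ?L {N'} (Suc n)"
      using assms[OF M] ext_dim_le_iff[OF C.B.is_cring] by blast
    obtain N where N: "N \<in> fg_modules R" "is_corner R \<alpha> N' N"
      using F.corner_exists[OF fg_modulesD[OF N'(1)]] by blast
    have "X \<in> ext_layer R {N} (Suc n)"
      if K: "K \<in> Omega R j" and X: "X \<in> fg_modules R" "is_corner R ((\<otimes>) C.e) K X" for K X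
    proof -
      have fgK: "K \<in> fg_modules R" using K U by blast
      obtain Y where Y: "Y \<in> fg_modules ?L" "is_corner ?L \<beta> K Y"
        using C.corner_exists[OF fg_modulesD[OF fgK]] by blast
      obtain X' where X': "X' \<in> fg_modules R" "is_corner R \<alpha> Y X'"
        using F.corner_exists[OF fg_modulesD[OF Y(1)]] by blast
      note m = fg_modulesD(1)[OF fgK] fg_modulesD(1)[OF Y(1)] fg_modulesD(1)[OF X'(1)] fg_modulesD(1)[OF X(1)]
      have "Y \<in> ext_layer ?L {N'} (Suc n)" using C.Omega_corner[OF K Y] N'(2) by blast
      then have "X' \<in> ext_layer R {N} (Suc n)" by (rule F.ext_layer_corner[OF N'(1) N _ X'])
      moreover have "mod_iso R X' X"
        using C.corner_comp[OF m(1-3) Y(2) X'(2)] X(2) by (rule E.corner_unique[OF m(1,3,4)])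
      ultimately show ?thesis using X(1) ext_layer_iso by blast
    qed
    then have "corners_bounded R (Omega R j) n C.e" using idem N(1) by (auto simp: corners_bounded_def)
    with notin show ?thesis by blast
  qed
  then have "corners_bounded R (Omega R j) n \<one>" by (rule corners_bounded_one[OF U])
  then obtain N where N: "N \<in> fg_modules R"
    and layer: "\<And>K X. K \<in> Omega R j \<Longrightarrow> X \<in> fg_modules R \<Longrightarrow> is_corner R ((\<otimes>) \<one>) K X \<Longrightarrow>
      X \<in> ext_layer R {N} (Suc n)" unfolding corners_bounded_def by blast
  have "is_corner R ((\<otimes>) \<one>) K K" if "K \<in> Omega R j" for K
  proof -
    interpret K: Module.module R K using that U fg_modulesD(1) by blast
    have "corner_map R ((\<otimes>) \<one>) K K (\<lambda>x. x)" by (simp add: corner_map_def)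
    then show ?thesis by (auto simp: is_corner_def)
  qed
  then have "Omega R j \<subseteq> ext_layer R {N} (Suc n)" using layer U by blast
  then show ?thesis using N ext_dim_le_iff[OF is_cring] by blast
qed

theorem theorem1p3:
  fixes R :: "('a, 'b) ring_scheme" and j n :: nat
  assumes "artinian_cring R"
  shows
    "(ext_dim R (Omega R j) \<le> enat n \<longleftrightarrow>
      (\<forall>P. primeideal P R \<longrightarrow> ext_dim (localization_at R P) (Omega (localization_at R P) j) \<le> enat n)) \<and>
     ((\<forall>P. primeideal P R \<longrightarrow> ext_dim (localization_at R P) (Omega (localization_at R P) j) \<le> enat n) \<longleftrightarrow>
      (\<forall>M. maximalideal M R \<longrightarrow> ext_dim (localization_at R M) (Omega (localization_at R M) j) \<le> enat n))"
proof -
  interpret artinian_cring R by fact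
  have "ext_dim (localization_at R P) (Omega (localization_at R P) j) \<le> enat n"
    if le: "ext_dim R (Omega R j) \<le> enat n" and P: "primeideal P R" for P
  proof -
    obtain \<alpha> \<beta> where "common_corner R (localization_at R P) \<alpha> \<beta>" "\<alpha> \<one>\<^bsub>R\<^esub> = \<one>\<^bsub>localization_at R P\<^esub>"
      using localization_common_corner[OF P] by blast
    then show ?thesis using le by (rule common_corner.ext_dim_Omega_corner)
  qed
  moreover have "primeideal M R" if "maximalideal M R" for M using that by (rule maximalideal_prime)
  ultimately show ?thesis using ext_dim_Omega_local_global by blast
qed

end
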